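(* Let $\theta$ be an inner function. (1) $\sigma_e(D_z^\theta)=\sigma_e(D_{\bar z}^\theta)=\mathbb T$. (2) $\sigma_p(D_z^\theta)=\sigma_p(D_{\bar z}^\theta)$, and each of $\sigma(D_z^\theta)$ and $\sigma(D_{\bar z}^\theta)$ is the disjoint union of $\mathbb T$ with this set, where $\sigma_p(D_z^\theta)=\emptyset$ if $\theta(0)\neq0$ and $\sigma_p(D_z^\theta)=\mathbb D$ if $\theta(0)=0$.
   Context: $L^2=L^2(\mathbb T)$, $\mathbb T$ the unit circle; $H^2$ is the Hardy space of the unit disk $\mathbb D$, viewed as a subspace of $L^2$. For an inner function $\theta$, $K_\theta=H^2\ominus\theta H^2$, $(K_\theta)^\perp=L^2\ominus K_\theta$, and $Q_\theta$ is the orthogonal projection of $L^2$ onto $(K_\theta)^\perp$. For $\varphi\in L^\infty(\mathbb T)$, $D_\varphi^{\theta}\colon (K_\theta)^\perp\to(K_\theta)^\perp$ is the dual truncated Toeplitz operator $D_\varphi^{\theta}f=Q_\theta(\varphi f)$; $D_z^\theta$ (dual truncated shift) and $D_{\bar z}^\theta$ are the cases $\varphi(z)=z$ and $\varphi(z)=\bar z$. $\sigma$, $\sigma_p$ denote the spectrum and point spectrum (set of eigenvalues), and $\sigma_e(T)=\{\lambda\in\mathbb C: T-\lambda I\text{ is not Fredholm}\}$. *)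

theory Defs
  imports "HOL-Complex_Analysis.Complex_Analysis"
begin

section \<open>The Hilbert space of square-integrable functions on the unit circle\<close>

definition circle_measure :: "complex measure" where
  "circle_measure =
     distr (uniform_measure lborel {0..2 * pi}) (restrict_space borel (sphere 0 1)) cis"

definition sq_integrable :: "(complex \<Rightarrow> complex) set" where
  "sq_integrable = {f \<in> borel_measurable circle_measure.
     integrable circle_measure (\<lambda>z. (cmod (f z))\<^sup>2)}"

definition L2_rel :: "(complex \<Rightarrow> complex) \<Rightarrow> (complex \<Rightarrow> complex) \<Rightarrow> bool" where
  "L2_rel f g \<longleftrightarrow> f \<in> sq_integrable \<and> g \<in> sq_integrable \<and> (AE z in circle_measure. f z = g z)"

lemma zero_sq_integrable: "(\<lambda>_. 0) \<in> sq_integrable"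
  by (simp add: sq_integrable_def)

lemma scale_sq_integrable: "f \<in> sq_integrable \<Longrightarrow> (\<lambda>z. c * f z) \<in> sq_integrable"
  by (auto simp: sq_integrable_def norm_mult power_mult_distrib)

lemma prod_integrable:
  assumes "f \<in> sq_integrable" "g \<in> sq_integrable"
  shows "integrable circle_measure (\<lambda>z. f z * cnj (g z))"
proof (rule Bochner_Integration.integrable_bound)
  show "integrable circle_measure (\<lambda>z. (cmod (f z))\<^sup>2 + (cmod (g z))\<^sup>2)"
    using assms by (auto simp: sq_integrable_def)
  have fg: "f \<in> borel_measurable circle_measure" "g \<in> borel_measurable circle_measure"
    using assms by (auto simp: sq_integrable_def)
  have "cnj \<in> borel_measurable borel"
    by (intro borel_measurable_continuous_onI continuous_intros)
  from measurable_compose[OF fg(2) this]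
  show "(\<lambda>z. f z * cnj (g z)) \<in> borel_measurable circle_measure"
    by (intro borel_measurable_times fg)
  have "a * b \<le> a\<^sup>2 + b\<^sup>2" if "0 \<le> a" "0 \<le> b" for a b :: real
    using sum_squares_bound[of a b] that mult_nonneg_nonneg[OF that] by linarith
  then show "AE z in circle_measure. norm (f z * cnj (g z)) \<le> norm ((cmod (f z))\<^sup>2 + (cmod (g z))\<^sup>2)"
    by (intro always_eventually allI) (simp add: norm_mult)
qed

lemma add_sq_integrable:
  assumes "f \<in> sq_integrable" "g \<in> sq_integrable"
  shows "(\<lambda>z. f z + g z) \<in> sq_integrable"
proof -
  have [measurable]: "f \<in> borel_measurable circle_measure" "g \<in> borel_measurable circle_measure"
    using assms by (auto simp: sq_integrable_def)
  have "integrable circle_measure (\<lambda>z. (cmod (f z + g z))\<^sup>2)"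
  proof (rule Bochner_Integration.integrable_bound)
    show "integrable circle_measure (\<lambda>z. 2 * (cmod (f z))\<^sup>2 + 2 * (cmod (g z))\<^sup>2)"
      using assms by (auto simp: sq_integrable_def)
    have "(cmod (a + b))\<^sup>2 \<le> 2 * (cmod a)\<^sup>2 + 2 * (cmod b)\<^sup>2" for a b :: complex
    proof -
      have "(cmod (a + b))\<^sup>2 \<le> (cmod a + cmod b)\<^sup>2"
        by (intro power_mono norm_triangle_ineq) simp
      also have "\<dots> \<le> 2 * (cmod a)\<^sup>2 + 2 * (cmod b)\<^sup>2"
        using sum_squares_bound[of "cmod a" "cmod b"] by (simp add: power2_sum)
      finally show ?thesis .
    qed
    then show "AE z in circle_measure. norm ((cmod (f z + g z))\<^sup>2)
        \<le> norm (2 * (cmod (f z))\<^sup>2 + 2 * (cmod (g z))\<^sup>2)"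
      by (intro always_eventually allI) simp
  qed simp
  then show ?thesis
    by (simp add: sq_integrable_def)
qed

quotient_type L2_circle = "complex \<Rightarrow> complex" / partial: L2_rel
  morphisms rep_L2 abs_L2
proof (rule part_equivpI)
  show "\<exists>f. L2_rel f f"
    using zero_sq_integrable by (auto simp: L2_rel_def)
  show "symp L2_rel"
    by (auto simp: symp_def L2_rel_def)
  show "transp L2_rel"
    unfolding transp_def L2_rel_def by (auto elim: AE_mp)
qed

lift_definition scaleC :: "complex \<Rightarrow> L2_circle \<Rightarrow> L2_circle" (infixr "*\<^sub>C" 75)
  is "\<lambda>c f z. c * f z"
  unfolding L2_rel_def by (auto simp: scale_sq_integrable elim: AE_mp)

lift_definition cinner :: "L2_circle \<Rightarrow> L2_circle \<Rightarrow> complex"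
  is "\<lambda>f g. \<integral>z. f z * cnj (g z) \<partial>circle_measure"
proof -
  fix f f' g g' assume *: "L2_rel f f'" "L2_rel g g'"
  have "(\<lambda>z. f z * cnj (g z)) \<in> borel_measurable circle_measure"
       "(\<lambda>z. f' z * cnj (g' z)) \<in> borel_measurable circle_measure"
    using * prod_integrable by (auto simp: L2_rel_def intro!: borel_measurable_integrable)
  moreover have "AE z in circle_measure. f z * cnj (g z) = f' z * cnj (g' z)"
    using * by (auto simp: L2_rel_def elim: AE_mp)
  ultimately show "(\<integral>z. f z * cnj (g z) \<partial>circle_measure) = (\<integral>z. f' z * cnj (g' z) \<partial>circle_measure)"
    by (rule integral_cong_AE)
qed

instantiation L2_circle :: real_inner
begin

lift_definition zero_L2_circle :: L2_circle is "\<lambda>_. 0"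
  by (simp add: L2_rel_def zero_sq_integrable)

lift_definition plus_L2_circle :: "L2_circle \<Rightarrow> L2_circle \<Rightarrow> L2_circle" is "\<lambda>f g z. f z + g z"
  unfolding L2_rel_def by (auto simp: add_sq_integrable elim: AE_mp)

definition uminus_L2_circle :: "L2_circle \<Rightarrow> L2_circle" where
  "- f = (-1) *\<^sub>C f"

definition minus_L2_circle :: "L2_circle \<Rightarrow> L2_circle \<Rightarrow> L2_circle" where
  "f - g = f + (- g :: L2_circle)"

definition scaleR_L2_circle :: "real \<Rightarrow> L2_circle \<Rightarrow> L2_circle" where
  "r *\<^sub>R f = of_real r *\<^sub>C f"

definition inner_L2_circle :: "L2_circle \<Rightarrow> L2_circle \<Rightarrow> real" where
  "inner f g = Re (cinner f g)"

definition norm_L2_circle :: "L2_circle \<Rightarrow> real" where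
  "norm (f :: L2_circle) = sqrt (inner f f)"

definition dist_L2_circle :: "L2_circle \<Rightarrow> L2_circle \<Rightarrow> real" where
  "dist (f :: L2_circle) g = norm (f - g)"

definition sgn_L2_circle :: "L2_circle \<Rightarrow> L2_circle" where
  "sgn (f :: L2_circle) = inverse (norm f) *\<^sub>R f"

definition uniformity_L2_circle :: "(L2_circle \<times> L2_circle) filter" where
  "uniformity = (INF e\<in>{0<..}. principal {(x, y). dist x (y :: L2_circle) < e})"

definition open_L2_circle :: "L2_circle set \<Rightarrow> bool" where
  "open (U :: L2_circle set) \<longleftrightarrow> (\<forall>x\<in>U. \<forall>\<^sub>F (x', y) in uniformity. x' = x \<longrightarrow> y \<in> U)"

lemma scaleC_algebra:
  fixes f g :: L2_circle
  shows "a *\<^sub>C (f + g) = a *\<^sub>C f + a *\<^sub>C g"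
    and "(a + b) *\<^sub>C f = a *\<^sub>C f + b *\<^sub>C f"
    and "a *\<^sub>C b *\<^sub>C f = (a * b) *\<^sub>C f"
    and "1 *\<^sub>C f = f"
    and "0 *\<^sub>C f = 0"
      apply (transfer, simp add: L2_rel_def add_sq_integrable scale_sq_integrable algebra_simps)
     apply (transfer, simp add: L2_rel_def add_sq_integrable scale_sq_integrable distrib_right)
    apply (transfer, simp add: L2_rel_def scale_sq_integrable mult.assoc)
   apply (transfer, simp add: L2_rel_def)
  apply (transfer, simp add: L2_rel_def zero_sq_integrable)
  done

lemma cinner_add_left: "cinner (f + g) h = cinner f h + cinner g h" for f g h :: L2_circle
  by transfer (simp add: L2_rel_def distrib_right prod_integrable)

lemma cinner_scaleC_left: "cinner (a *\<^sub>C f) h = a * cinner f h"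
  by transfer (simp add: mult.assoc)

lemma cinner_commute: "cinner f g = cnj (cinner g f)"
  by transfer (simp flip: Bochner_Integration.integral_cnj add: mult.commute)

lemma cinner_self_eq_integral:
  "f \<in> sq_integrable \<Longrightarrow> (\<integral>z. f z * cnj (f z) \<partial>circle_measure)
     = of_real (\<integral>z. (cmod (f z))\<^sup>2 \<partial>circle_measure)"
  by (simp flip: integral_complex_of_real add: complex_norm_square del: of_real_power)

lemma Re_cinner_nonneg: "0 \<le> Re (cinner f f)"
  by transfer (simp add: L2_rel_def cinner_self_eq_integral)

lemma Re_cinner_eq_0: "Re (cinner f f) = 0 \<longleftrightarrow> f = 0"
proof (transfer, goal_cases)
  case (1 f)
  then have f: "f \<in> sq_integrable" by (simp add: L2_rel_def)
  have "(\<integral>z. (cmod (f z))\<^sup>2 \<partial>circle_measure) = 0 \<longleftrightarrow> (AE z in circle_measure. (cmod (f z))\<^sup>2 = 0)"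
    by (rule integral_nonneg_eq_0_iff_AE) (use f in \<open>auto simp: sq_integrable_def\<close>)
  then show ?case
    using f by (simp add: cinner_self_eq_integral L2_rel_def zero_sq_integrable)
qed

instance
proof
  fix a b :: real and x y z :: L2_circle
  show "x + y + z = x + (y + z)"
    by transfer (simp add: L2_rel_def add_sq_integrable add.assoc)
  show "x + y = y + x"
    by transfer (simp add: L2_rel_def add_sq_integrable add.commute)
  show "0 + x = x"
    by transfer (simp add: L2_rel_def)
  show "- x + x = 0"
    using scaleC_algebra(2)[of "-1" 1 x]
    by (simp add: uminus_L2_circle_def scaleC_algebra)
  show "x - y = x + - y"
    by (simp add: minus_L2_circle_def)
  show "a *\<^sub>R (x + y) = a *\<^sub>R x + a *\<^sub>R y" "(a + b) *\<^sub>R x = a *\<^sub>R x + b *\<^sub>R x"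
    "a *\<^sub>R b *\<^sub>R x = (a * b) *\<^sub>R x" "1 *\<^sub>R x = x"
    by (simp_all add: scaleR_L2_circle_def scaleC_algebra)
  show "inner x y = inner y x"
    unfolding inner_L2_circle_def by (subst cinner_commute) simp
  show "inner (x + y) z = inner x z + inner y z"
    by (simp add: inner_L2_circle_def cinner_add_left)
  show "inner (a *\<^sub>R x) y = a * inner x y"
    by (simp add: inner_L2_circle_def scaleR_L2_circle_def cinner_scaleC_left)
  show "0 \<le> inner x x"
    by (simp add: inner_L2_circle_def Re_cinner_nonneg)
  show "inner x x = 0 \<longleftrightarrow> x = 0"
    by (simp add: inner_L2_circle_def Re_cinner_eq_0)
qed (rule norm_L2_circle_def dist_L2_circle_def sgn_L2_circle_def uniformity_L2_circle_def
      open_L2_circle_def)+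

end

interpretation L2: vector_space scaleC
  by unfold_locales (simp_all add: scaleC_algebra)

definition orth :: "L2_circle set \<Rightarrow> L2_circle set" where
  "orth M = {f. \<forall>g\<in>M. cinner f g = 0}"

definition proj :: "L2_circle set \<Rightarrow> L2_circle \<Rightarrow> L2_circle" where
  "proj M f = (THE g. g \<in> M \<and> f - g \<in> orth M)"

text \<open>Pointwise multiplication by a symbol. It does not depend on the chosen representative and
  is the usual multiplication operator whenever \<^term>\<open>\<phi>\<close> is essentially bounded.\<close>

definition mult_L2 :: "(complex \<Rightarrow> complex) \<Rightarrow> L2_circle \<Rightarrow> L2_circle" where
  "mult_L2 \<phi> f = abs_L2 (\<lambda>z. \<phi> z * rep_L2 f z)"


section \<open>Operators on a closed subspace\<close>

text \<open>An operator on a closed subspace \<^term>\<open>M\<close> is a function on the whole space of which only the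
  values on \<^term>\<open>M\<close> matter.\<close>

definition bounded_op_on :: "L2_circle set \<Rightarrow> (L2_circle \<Rightarrow> L2_circle) \<Rightarrow> bool" where
  "bounded_op_on M T \<longleftrightarrow>
     (\<forall>f\<in>M. T f \<in> M) \<and>
     (\<forall>f\<in>M. \<forall>g\<in>M. T (f + g) = T f + T g) \<and>
     (\<forall>c. \<forall>f\<in>M. T (c *\<^sub>C f) = c *\<^sub>C T f) \<and>
     (\<exists>C. \<forall>f\<in>M. norm (T f) \<le> C * norm f)"

definition invertible_on :: "L2_circle set \<Rightarrow> (L2_circle \<Rightarrow> L2_circle) \<Rightarrow> bool" where
  "invertible_on M T \<longleftrightarrow>
     (\<exists>S. bounded_op_on M S \<and> (\<forall>f\<in>M. S (T f) = f) \<and> (\<forall>f\<in>M. T (S f) = f))"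

definition fredholm_on :: "L2_circle set \<Rightarrow> (L2_circle \<Rightarrow> L2_circle) \<Rightarrow> bool" where
  "fredholm_on M T \<longleftrightarrow>
     closed (T ` M) \<and>
     (\<exists>B. finite B \<and> {f \<in> M. T f = 0} \<subseteq> L2.span B) \<and>
     (\<exists>B. finite B \<and> M \<subseteq> L2.span (T ` M \<union> B))"

definition spectrum_on :: "L2_circle set \<Rightarrow> (L2_circle \<Rightarrow> L2_circle) \<Rightarrow> complex set" where
  "spectrum_on M T = {\<mu>. \<not> invertible_on M (\<lambda>f. T f - \<mu> *\<^sub>C f)}"

definition point_spectrum_on :: "L2_circle set \<Rightarrow> (L2_circle \<Rightarrow> L2_circle) \<Rightarrow> complex set" where
  "point_spectrum_on M T = {\<mu>. \<exists>f\<in>M. f \<noteq> 0 \<and> T f = \<mu> *\<^sub>C f}"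

definition ess_spectrum_on :: "L2_circle set \<Rightarrow> (L2_circle \<Rightarrow> L2_circle) \<Rightarrow> complex set" where
  "ess_spectrum_on M T = {\<mu>. \<not> fredholm_on M (\<lambda>f. T f - \<mu> *\<^sub>C f)}"


section \<open>Hardy space, inner functions, model spaces\<close>

definition hardy_H2_disk :: "(complex \<Rightarrow> complex) set" where
  "hardy_H2_disk = {F. F holomorphic_on ball 0 1 \<and>
     (\<exists>C. \<forall>r\<in>{0..<1}. (\<integral>z. (cmod (F (of_real r * z)))\<^sup>2 \<partial>circle_measure) \<le> C)}"

text \<open>A function in the Hardy space of the disk is identified with its boundary function, the
  limit in the mean of its dilates as the radius increases to one.\<close>

definition H2 :: "L2_circle set" where
  "H2 = {f. \<exists>F\<in>hardy_H2_disk. ((\<lambda>r. abs_L2 (\<lambda>z. F (of_real r * z))) \<longlongrightarrow> f) (at_left (1::real))}"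

definition radial_limit :: "(complex \<Rightarrow> complex) \<Rightarrow> complex \<Rightarrow> complex" where
  "radial_limit \<theta> z = Lim (at_left (1::real)) (\<lambda>r. \<theta> (of_real r * z))"

definition inner_function :: "(complex \<Rightarrow> complex) \<Rightarrow> bool" where
  "inner_function \<theta> \<longleftrightarrow> \<theta> holomorphic_on ball 0 1 \<and> bounded (\<theta> ` ball 0 1) \<and>
     (AE z in circle_measure.
        \<exists>u. cmod u = 1 \<and> ((\<lambda>r. \<theta> (of_real r * z)) \<longlongrightarrow> u) (at_left (1::real)))"

definition model_space :: "(complex \<Rightarrow> complex) \<Rightarrow> L2_circle set" where
  "model_space \<theta> = H2 \<inter> orth (mult_L2 (radial_limit \<theta>) ` H2)"

definition model_space_perp :: "(complex \<Rightarrow> complex) \<Rightarrow> L2_circle set" where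
  "model_space_perp \<theta> = orth (model_space \<theta>)"

definition dual_TTO :: "(complex \<Rightarrow> complex) \<Rightarrow> (complex \<Rightarrow> complex) \<Rightarrow> L2_circle \<Rightarrow> L2_circle" where
  "dual_TTO \<theta> \<phi> f = proj (model_space_perp \<theta>) (mult_L2 \<phi> f)"

end

theory Submission
  imports Defs "HOL-Probability.Probability_Measure"
begin

text \<open>
  Split \<open>L\<^sup>2\<close> into its coanalytic part (Fourier coefficients of nonnegative index vanish) and
  its analytic part \<open>H\<^sup>2\<close>.  The orthogonal complement of the model space consists of the
  functions \<open>g + \<theta> h\<close> with \<open>g\<close> coanalytic and \<open>h\<close> analytic, and the map \<open>J\<close> that sends
  \<open>g + h\<close> to \<open>g + \<theta> h\<close> is an isometry of \<open>L\<^sup>2\<close> onto it.  In the orthonormal system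
  \<open>J z\<^sup>n\<close>, \<open>n\<close> an integer, the dual truncated shift is a bilateral shift with all weights equal to
  one, except for a single weight \<open>a\<close>: the step from \<open>z\<^sup>-\<^sup>1\<close> leads to the constant \<open>1\<close>, whose
  component outside the model space is \<open>cnj (\<theta> 0) \<theta>\<close>, so \<open>a = cnj (\<theta> 0)\<close>.  The operator with
  symbol \<open>cnj z\<close> has the same shape, with the shift running in the opposite direction and
  \<open>a = \<theta> 0\<close>; this is why the shift is studied for an abstract unimodular symbol \<open>u\<close>
  (locale \<open>weighted_shift\<close>) and both operators are obtained as instances
  (\<open>dual_TTO_id_J\<close> and \<open>dual_TTO_cnj_J\<close>).

  The weighted shift \<open>T\<close> is a perturbation of rank one of multiplication by \<open>u\<close>, which gives its
  spectra by hand.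
  For \<open>\<bar>\<mu>\<bar> = 1\<close> the coefficients of an eigenvector would have constant modulus along each half of the
  orthonormal system, which square summability forbids, and the range of \<open>T - \<mu>\<close> fails to be
  closed, since the image of \<open>e\<close> under \<open>u\<close> lies in its closure but not in it
  (\<open>range_not_closed\<close>).
  For \<open>\<bar>\<mu>\<bar> \<noteq> 1\<close> multiplication by \<open>u - \<mu>\<close> is invertible, and the perturbation leaves it
  invertible unless a scalar vanishes; the scalar is \<open>1\<close> outside the disk and \<open>a\<close> inside it
  (\<open>invertible_off_circle\<close>).  So only \<open>a = 0\<close> and \<open>\<bar>\<mu>\<bar> < 1\<close> is left, where kernel and cokernel
  both have dimension one (\<open>zero_weight_inside\<close>).

  The function theory behind \<open>J\<close> consists of the completeness of \<open>L\<^sup>2\<close>, which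
  provides the analytic part of a function, the description of \<open>H\<^sup>2\<close> by Fourier coefficients
  (\<open>H2_eq_analytic\<close>), and the fact that the radial limit of an inner function is a unimodular
  element of \<open>H\<^sup>2\<close> with mean value \<open>\<theta> 0\<close> (\<open>inner_analytic\<close>).
\<close>

section \<open>Normalised arc length on the unit circle\<close>

lemma measurable_cis_circle:
  "cis \<in> measurable (uniform_measure lborel {0..2 * pi}) (restrict_space borel (sphere 0 1))"
proof -
  have "cis \<in> borel_measurable borel"
    by (intro borel_measurable_continuous_onI continuous_intros)
  then show ?thesis
    by (intro measurable_restrict_space2) (auto simp: measurable_def)
qed

lemma space_circle_measure [simp]: "space circle_measure = sphere 0 1"
  by (simp add: circle_measure_def space_restrict_space)

lemma sets_circle_measure:
  "sets circle_measure = sets (restrict_space borel (sphere 0 1))"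
  by (simp add: circle_measure_def)

lemma prob_space_circle_measure: "prob_space circle_measure"
proof -
  have "prob_space (uniform_measure lborel {0..2 * pi})"
    by (rule prob_space_uniform_measure) auto
  then show ?thesis
    unfolding circle_measure_def using measurable_cis_circle by (rule prob_space.prob_space_distr)
qed

interpretation circle: prob_space circle_measure
  by (rule prob_space_circle_measure)

lemma borel_measurable_circle_borel:
  "f \<in> borel_measurable borel \<Longrightarrow> f \<in> borel_measurable circle_measure"
  using measurable_restrict_space1[of f borel borel "sphere 0 1"]
  by (simp only: measurable_cong_sets[OF sets_circle_measure refl])

lemma AE_circle_norm: "AE z in circle_measure. cmod z = 1"
  by (rule AE_I2) auto

lemma integral_circle_measure:
  fixes f :: "complex \<Rightarrow> complex"
  assumes "f \<in> borel_measurable circle_measure"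
  shows "integral\<^sup>L circle_measure f
     = (1 / (2 * pi)) *\<^sub>R (LBINT t. indicator {0..2*pi} t *\<^sub>R f (cis t))"
proof -
  have f: "f \<in> borel_measurable (restrict_space borel (sphere 0 1))"
    using assms by (simp only: measurable_cong_sets[OF sets_circle_measure refl])
  have m: "(\<lambda>t. f (cis t)) \<in> borel_measurable (uniform_measure lborel {0..2 * pi})"
    by (rule measurable_compose[OF measurable_cis_circle f])
  then have m': "(\<lambda>t. f (cis t)) \<in> borel_measurable lborel"
    by (simp add: measurable_def)
  have eq: "uniform_measure lborel {0..2*pi}
      = density lborel (\<lambda>t. ennreal (indicator {0..2*pi} t / (2*pi)))"
    unfolding uniform_measure_def
    by (intro density_cong) (auto simp: indicator_def ennreal_1[symmetric] divide_ennreal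
        simp del: ennreal_1)
  have "integral\<^sup>L circle_measure f = (\<integral>t. f (cis t) \<partial>uniform_measure lborel {0..2*pi})"
    unfolding circle_measure_def by (rule integral_distr[OF measurable_cis_circle f])
  also have "\<dots> = (LBINT t. (indicator {0..2*pi} t / (2*pi)) *\<^sub>R f (cis t))"
    unfolding eq by (rule integral_density[OF m']) auto
  also have "\<dots> = (LBINT t. (1/(2*pi)) *\<^sub>R (indicator {0..2*pi} t *\<^sub>R f (cis t)))"
    by (simp only: scaleR_scaleR times_divide_eq_left mult_1)
  finally show ?thesis by (simp only: integral_scaleR_right)
qed

lemma integral_power_circle:
  assumes "n > 0"
  shows "(\<integral>z. z ^ n \<partial>circle_measure) = 0"
proof -
  let ?F = "\<lambda>t::real. cis (n * t) / (\<i> * n)"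
  have "(?F has_vector_derivative cis t ^ n) (at t within {0..2*pi})" for t
  proof -
    have "((\<lambda>t. cis (n * t)) has_vector_derivative n *\<^sub>R (\<i> * cis (n * t))) (at t within {0..2*pi})"
      unfolding has_vector_derivative_def by (rule derivative_eq_intros refl)+ (simp add: fun_eq_iff)
    then have "(?F has_vector_derivative (n *\<^sub>R (\<i> * cis (n * t))) / (\<i> * n)) (at t within {0..2*pi})"
      by (rule has_vector_derivative_divide)
    then show ?thesis
      using assms unfolding Complex.DeMoivre by (simp add: scaleR_conv_of_real)
  qed
  then have "(LBINT t. indicator {0..2*pi} t *\<^sub>R cis t ^ n) = ?F (2*pi) - ?F 0"
    by (intro integral_FTC_Icc) (auto intro!: continuous_intros)
  moreover have "cis (n * (2*pi)) = 1"
    using cis_multiple_2pi[of "real n"] by (simp add: mult_ac)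
  ultimately show ?thesis
    by (subst integral_circle_measure) (auto intro: borel_measurable_circle_borel)
qed

text \<open>Only countably many angles represent a given point.\<close>

lemma AE_circle_neq: "AE z in circle_measure. z \<noteq> w"
proof (cases "cmod w = 1")
  case False
  then show ?thesis using AE_circle_norm by auto
next
  case True
  then obtain s where s: "w = cis s" by (metis complex_norm_eq_1_exp cis_conv_exp)
  have "{t. cis t = w} \<subseteq> range (\<lambda>n::int. s + 2 * n * pi)"
  proof (clarsimp simp: s cis_conv_exp exp_eq)
    fix t and n :: int
    assume "\<i> * complex_of_real t = \<i> * complex_of_real s + 2 * complex_of_int n * complex_of_real pi * \<i>"
    then have "\<i> * complex_of_real t = \<i> * complex_of_real (s + 2 * n * pi)"
      by (simp add: algebra_simps)
    then have "t = s + 2 * n * pi" by (metis complex_i_not_zero mult_left_cancel of_real_eq_iff)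
    then show "t \<in> range (\<lambda>n::int. s + 2 * n * pi)" by (intro image_eqI[of _ _ n]) auto
  qed
  then have "countable {t. cis t = w}"
    by (rule countable_subset) auto
  then have "AE t in lborel. cis t \<noteq> w"
    by (intro AE_I'[OF countable_imp_null_set_lborel]) auto
  then have "AE t in uniform_measure lborel {0..2*pi}. cis t \<noteq> w"
    by (intro AE_uniform_measureI) auto
  then show ?thesis
    unfolding circle_measure_def
    by (subst AE_distr_iff[OF measurable_cis_circle])
       (auto simp: sets_restrict_space_iff intro!: borel_closed)
qed

section \<open>Square-integrable functions and multiplication operators\<close>

lemma L2_rel_rep: "L2_rel (rep_L2 f) (rep_L2 f)"
  by (rule Quotient_rep_reflp[OF Quotient_L2_circle])

lemma L2_rel_refl: "L2_rel f f \<longleftrightarrow> f \<in> sq_integrable"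
  by (auto simp: L2_rel_def)

lemma rep_L2_sq_integrable [simp]: "rep_L2 f \<in> sq_integrable"
  using L2_rel_rep by (simp add: L2_rel_refl)

lemma abs_rep_L2 [simp]: "abs_L2 (rep_L2 f) = f"
  by (rule Quotient_abs_rep[OF Quotient_L2_circle])

lemma L2_cases [cases type: L2_circle]:
  obtains f' where "f = abs_L2 f'" "f' \<in> sq_integrable"
  by (rule that[of "rep_L2 f"]) auto

lemma abs_L2_eqI:
  "\<lbrakk>f \<in> sq_integrable; g \<in> sq_integrable; AE z in circle_measure. f z = g z\<rbrakk>
    \<Longrightarrow> abs_L2 f = abs_L2 g"
  by (rule Quotient_rel_abs[OF Quotient_L2_circle]) (simp add: L2_rel_def)

lemma AE_rep_abs_L2:
  "f \<in> sq_integrable \<Longrightarrow> AE z in circle_measure. rep_L2 (abs_L2 f) z = f z"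
  using Quotient_rep_abs[OF Quotient_L2_circle, of f] by (auto simp: L2_rel_def)

lemmas plus_abs_L2 = plus_L2_circle.abs_eq[unfolded L2_rel_refl]
lemmas scaleC_abs_L2 = scaleC.abs_eq[unfolded L2_rel_refl]
lemmas cinner_abs_L2 = cinner.abs_eq[unfolded L2_rel_refl]

lemma minus_abs_L2:
  assumes "f \<in> sq_integrable" "g \<in> sq_integrable"
  shows "abs_L2 f - abs_L2 g = abs_L2 (\<lambda>z. f z - g z)"
proof -
  have "abs_L2 f - abs_L2 g = abs_L2 f + (- 1) *\<^sub>C abs_L2 g"
    by (simp only: minus_L2_circle_def uminus_L2_circle_def)
  also have "\<dots> = abs_L2 (\<lambda>z. f z + - 1 * g z)"
    by (simp only: assms scaleC_abs_L2 plus_abs_L2 scale_sq_integrable)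
  finally show ?thesis by simp
qed

lemma diff_sq_integrable:
  "\<lbrakk>f \<in> sq_integrable; g \<in> sq_integrable\<rbrakk> \<Longrightarrow> (\<lambda>z. f z - g z) \<in> sq_integrable"
  using add_sq_integrable[of f "\<lambda>z. - 1 * g z"] scale_sq_integrable[of g "-1"] by simp

lemma norm_abs_L2:
  "f \<in> sq_integrable \<Longrightarrow> (norm (abs_L2 f))\<^sup>2 = (\<integral>z. (cmod (f z))\<^sup>2 \<partial>circle_measure)"
  by (simp add: norm_L2_circle_def inner_L2_circle_def cinner_abs_L2 cinner_self_eq_integral)

subsection \<open>Inner product\<close>

lemma scaleC_of_real: "of_real r *\<^sub>C f = r *\<^sub>R f"
  by (simp add: scaleR_L2_circle_def)

lemma scaleC_minus1: "- 1 *\<^sub>C f = - f"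
  by (simp only: uminus_L2_circle_def)

lemma cinner_minus_left: "cinner (- f) g = - cinner f g"
  by (simp only: uminus_L2_circle_def cinner_scaleC_left) simp

lemma cinner_diff_left: "cinner (f - g) h = cinner f h - cinner g h"
  unfolding minus_L2_circle_def[of f g] by (simp only: cinner_add_left cinner_minus_left) simp

lemma cinner_zero_left [simp]: "cinner 0 f = 0"
  using cinner_diff_left[of f f f] by simp

lemma cinner_zero_right [simp]: "cinner f 0 = 0"
  by (subst cinner_commute) simp

lemma cinner_add_right: "cinner f (g + h) = cinner f g + cinner f h"
  using arg_cong[OF cinner_add_left[of g h f], of cnj] by (simp add: cinner_commute[symmetric])

lemma cinner_diff_right: "cinner f (g - h) = cinner f g - cinner f h"
  using arg_cong[OF cinner_diff_left[of g h f], of cnj] by (simp add: cinner_commute[symmetric])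

lemma cinner_scaleC_right: "cinner f (a *\<^sub>C g) = cnj a * cinner f g"
  using arg_cong[OF cinner_scaleC_left[of a g f], of cnj] by (simp add: cinner_commute[symmetric])

lemma cinner_sum_left: "cinner (sum F A) g = (\<Sum>n\<in>A. cinner (F n) g)"
  by (induction A rule: infinite_finite_induct) (auto simp: cinner_add_left)

lemma cinner_eq_0_commute: "cinner f g = 0 \<longleftrightarrow> cinner g f = 0"
  by (subst cinner_commute) simp

lemma cinner_self: "cinner f f = of_real ((norm f)\<^sup>2)"
proof (rule complex_eqI)
  have "Im (cinner f f) = - Im (cinner f f)"
    by (subst cinner_commute) simp
  then show "Im (cinner f f) = Im (of_real ((norm f)\<^sup>2))" by simp
qed (simp add: norm_L2_circle_def inner_L2_circle_def Re_cinner_nonneg)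

lemma norm_scaleC [simp]: "norm (a *\<^sub>C f) = cmod a * norm f"
proof -
  have "cinner (a *\<^sub>C f) (a *\<^sub>C f) = (a * cnj a) * cinner f f"
    by (simp only: cinner_scaleC_left cinner_scaleC_right mult_ac)
  then have "complex_of_real ((norm (a *\<^sub>C f))\<^sup>2) = of_real ((cmod a)\<^sup>2 * (norm f)\<^sup>2)"
    by (simp only: cinner_self complex_norm_square[symmetric] of_real_mult)
  then have "(norm (a *\<^sub>C f))\<^sup>2 = (cmod a * norm f)\<^sup>2"
    by (simp only: of_real_eq_iff power_mult_distrib)
  then show ?thesis
    by (rule power2_eq_imp_eq) auto
qed

lemma scaleC_diff_right: "a *\<^sub>C (f - g) = a *\<^sub>C f - a *\<^sub>C g"
  by (rule L2.scale_right_diff_distrib)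

lemma cinner_Cauchy_Schwarz: "cmod (cinner f g) \<le> norm f * norm g"
proof -
  define c where "c = cnj (sgn (cinner f g))"
  have "cmod (cinner f g) = Re (c * cinner f g)"
  proof -
    have "c * cinner f g = of_real (cmod (cinner f g))"
      by (simp add: c_def sgn_eq complex_norm_square[symmetric] power2_eq_square mult.commute divide_simps)
    then show ?thesis by simp
  qed
  also have "\<dots> = inner (c *\<^sub>C f) g"
    by (simp add: inner_L2_circle_def cinner_scaleC_left)
  also have "\<dots> \<le> norm (c *\<^sub>C f) * norm g"
    by (rule norm_cauchy_schwarz)
  also have "\<dots> \<le> 1 * norm f * norm g"
    unfolding norm_scaleC by (intro mult_right_mono) (auto simp: c_def norm_sgn)
  finally show ?thesis by simp
qed

lemma bounded_linear_cinner_left: "bounded_linear (\<lambda>f. cinner f g)"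
  by (rule bounded_linear_intro[of _ "norm g"])
     (simp_all add: cinner_add_left scaleC_of_real[symmetric] cinner_scaleC_left scaleR_conv_of_real
       cinner_Cauchy_Schwarz)

lemmas tendsto_cinner_left = bounded_linear.tendsto[OF bounded_linear_cinner_left]
lemmas continuous_on_cinner_left = bounded_linear.continuous_on[OF bounded_linear_cinner_left]

lemma closed_orth: "closed (orth M)"
proof -
  have "orth M = (\<Inter>g\<in>M. {f. cinner f g = 0})"
    by (auto simp: orth_def)
  moreover have "closed {f. cinner f g = 0}" for g
    by (intro closed_Collect_eq continuous_on_cinner_left continuous_intros)
  ultimately show ?thesis by auto
qed

lemma orth_add: "\<lbrakk>f \<in> orth M; g \<in> orth M\<rbrakk> \<Longrightarrow> f + g \<in> orth M"
  by (simp add: orth_def cinner_add_left)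

lemma orth_diff: "\<lbrakk>f \<in> orth M; g \<in> orth M\<rbrakk> \<Longrightarrow> f - g \<in> orth M"
  by (simp add: orth_def cinner_diff_left)

lemma orth_scaleC: "f \<in> orth M \<Longrightarrow> a *\<^sub>C f \<in> orth M"
  by (simp add: orth_def cinner_scaleC_left)

text \<open>The decomposition along \<open>orth M\<close> is unique, so an explicit candidate identifies the projection.\<close>

lemma proj_orth_eqI:
  assumes "g \<in> orth M" "f - g \<in> orth (orth M)"
  shows "proj (orth M) f = g"
  unfolding proj_def
proof (rule the_equality)
  fix h assume h: "h \<in> orth M \<and> f - h \<in> orth (orth M)"
  have "h - g \<in> orth M" using h assms by (blast intro: orth_diff)
  moreover have "h - g \<in> orth (orth M)"
    using orth_diff[OF assms(2), of "f - h"] h by simp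
  ultimately have "cinner (h - g) (h - g) = 0"
    unfolding orth_def by blast
  then show "h = g" by (simp add: cinner_self)
qed (use assms in blast)

subsection \<open>Multiplication operators\<close>

definition ess_bounded :: "(complex \<Rightarrow> complex) \<Rightarrow> bool" where
  "ess_bounded \<phi> \<longleftrightarrow> \<phi> \<in> borel_measurable circle_measure \<and>
     (\<exists>C. AE z in circle_measure. cmod (\<phi> z) \<le> C)"

lemma mult_sq_integrable_bound:
  assumes "\<phi> \<in> borel_measurable circle_measure" "AE z in circle_measure. cmod (\<phi> z) \<le> C" "f \<in> sq_integrable"
  shows "(\<lambda>z. \<phi> z * f z) \<in> sq_integrable"
    and "0 \<le> C \<Longrightarrow> norm (abs_L2 (\<lambda>z. \<phi> z * f z)) \<le> C * norm (abs_L2 f)"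
proof -
  have [measurable]: "f \<in> borel_measurable circle_measure" "\<phi> \<in> borel_measurable circle_measure"
    and i: "integrable circle_measure (\<lambda>z. (cmod (f z))\<^sup>2)"
    using assms by (auto simp: sq_integrable_def)
  have b: "AE z in circle_measure. (cmod (\<phi> z * f z))\<^sup>2 \<le> C\<^sup>2 * (cmod (f z))\<^sup>2"
    using assms(2)
  proof eventually_elim
    case (elim z)
    have "(cmod (\<phi> z))\<^sup>2 * (cmod (f z))\<^sup>2 \<le> C\<^sup>2 * (cmod (f z))\<^sup>2"
      by (intro mult_right_mono power_mono elim) auto
    then show ?case by (simp only: norm_mult power_mult_distrib)
  qed
  have i2: "integrable circle_measure (\<lambda>z. C\<^sup>2 * (cmod (f z))\<^sup>2)"
    by (rule integrable_mult_right[OF i])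
  have i': "integrable circle_measure (\<lambda>z. (cmod (\<phi> z * f z))\<^sup>2)"
  proof (rule Bochner_Integration.integrable_bound[OF i2])
    show "AE z in circle_measure. norm ((cmod (\<phi> z * f z))\<^sup>2) \<le> norm (C\<^sup>2 * (cmod (f z))\<^sup>2)"
      using b by eventually_elim simp
  qed simp
  then show m: "(\<lambda>z. \<phi> z * f z) \<in> sq_integrable"
    by (simp add: sq_integrable_def)
  assume "0 \<le> C"
  have "(norm (abs_L2 (\<lambda>z. \<phi> z * f z)))\<^sup>2 \<le> (\<integral>z. C\<^sup>2 * (cmod (f z))\<^sup>2 \<partial>circle_measure)"
    unfolding norm_abs_L2[OF m] by (rule integral_mono_AE[OF i' i2 b])
  also have "\<dots> = (C * norm (abs_L2 f))\<^sup>2"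
    by (simp add: norm_abs_L2 assms power_mult_distrib)
  finally show "norm (abs_L2 (\<lambda>z. \<phi> z * f z)) \<le> C * norm (abs_L2 f)"
    by (rule power2_le_imp_le) (simp add: \<open>0 \<le> C\<close>)
qed

lemma mult_sq_integrable: "\<lbrakk>ess_bounded \<phi>; f \<in> sq_integrable\<rbrakk> \<Longrightarrow> (\<lambda>z. \<phi> z * f z) \<in> sq_integrable"
  using mult_sq_integrable_bound(1) by (auto simp: ess_bounded_def)

lemma mult_L2_abs:
  assumes "ess_bounded \<phi>" "f \<in> sq_integrable"
  shows "mult_L2 \<phi> (abs_L2 f) = abs_L2 (\<lambda>z. \<phi> z * f z)"
  unfolding mult_L2_def
  using AE_rep_abs_L2[OF assms(2)]
  by (intro abs_L2_eqI mult_sq_integrable assms rep_L2_sq_integrable) auto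

lemma mult_L2_add:
  assumes "ess_bounded \<phi>" shows "mult_L2 \<phi> (f + g) = mult_L2 \<phi> f + mult_L2 \<phi> g"
  by (cases f; cases g)
     (simp add: assms plus_abs_L2 mult_L2_abs add_sq_integrable mult_sq_integrable distrib_left)

lemma mult_L2_scaleC:
  assumes "ess_bounded \<phi>" shows "mult_L2 \<phi> (a *\<^sub>C f) = a *\<^sub>C mult_L2 \<phi> f"
  by (cases f)
     (simp add: assms scaleC_abs_L2 mult_L2_abs scale_sq_integrable mult_sq_integrable, simp add: mult_ac)

lemma mult_L2_diff:
  assumes "ess_bounded \<phi>" shows "mult_L2 \<phi> (f - g) = mult_L2 \<phi> f - mult_L2 \<phi> g"
  by (cases f; cases g)
     (simp add: assms minus_abs_L2 mult_L2_abs diff_sq_integrable mult_sq_integrable right_diff_distrib)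

lemma ess_bounded_const [simp]: "ess_bounded (\<lambda>_. c)"
  by (auto simp: ess_bounded_def)

lemma ess_bounded_mult:
  assumes "ess_bounded \<phi>" "ess_bounded \<psi>" shows "ess_bounded (\<lambda>z. \<phi> z * \<psi> z)"
proof -
  obtain C D where *: "AE z in circle_measure. cmod (\<phi> z) \<le> C" "AE z in circle_measure. cmod (\<psi> z) \<le> D"
    using assms by (auto simp: ess_bounded_def)
  have "AE z in circle_measure. cmod (\<phi> z * \<psi> z) \<le> C * D"
    using * by eventually_elim (simp add: norm_mult mult_mono')
  then show ?thesis using assms by (auto simp: ess_bounded_def)
qed

lemma ess_bounded_diff:
  assumes "ess_bounded \<phi>" "ess_bounded \<psi>" shows "ess_bounded (\<lambda>z. \<phi> z - \<psi> z)"
proof -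
  obtain C D where *: "AE z in circle_measure. cmod (\<phi> z) \<le> C" "AE z in circle_measure. cmod (\<psi> z) \<le> D"
    using assms by (auto simp: ess_bounded_def)
  have "AE z in circle_measure. cmod (\<phi> z - \<psi> z) \<le> C + D"
    using * by eventually_elim (meson norm_triangle_ineq4 add_mono order_trans)
  then show ?thesis using assms by (auto simp: ess_bounded_def)
qed

lemma ess_bounded_cnj: "ess_bounded \<phi> \<Longrightarrow> ess_bounded (\<lambda>z. cnj (\<phi> z))"
proof -
  have "cnj \<in> borel_measurable borel"
    by (intro borel_measurable_continuous_onI continuous_intros)
  then show "ess_bounded \<phi> \<Longrightarrow> ess_bounded (\<lambda>z. cnj (\<phi> z))"
    using measurable_compose[of \<phi> circle_measure borel cnj borel] by (simp add: ess_bounded_def)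
qed

lemma ess_bounded_unimodular:
  "\<lbrakk>\<phi> \<in> borel_measurable circle_measure; AE z in circle_measure. cmod (\<phi> z) = 1\<rbrakk> \<Longrightarrow> ess_bounded \<phi>"
  unfolding ess_bounded_def by (auto intro!: exI[of _ 1] elim: eventually_mono)

lemma ess_bounded_id [simp]: "ess_bounded (\<lambda>z. z)" and ess_bounded_cnj_id [simp]: "ess_bounded cnj"
  and ess_bounded_power [simp]: "ess_bounded (\<lambda>z. z ^ n)"
  by (intro ess_bounded_unimodular borel_measurable_circle_borel borel_measurable_continuous_onI
      continuous_intros eventually_mono[OF AE_circle_norm]; simp add: norm_power)+

lemma mult_L2_mult:
  assumes "ess_bounded \<phi>" "ess_bounded \<psi>"
  shows "mult_L2 \<phi> (mult_L2 \<psi> f) = mult_L2 (\<lambda>z. \<phi> z * \<psi> z) f"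
  by (cases f) (simp add: assms mult_L2_abs mult_sq_integrable ess_bounded_mult mult.assoc)

lemma mult_L2_cong:
  assumes "ess_bounded \<phi>" "ess_bounded \<psi>" "AE z in circle_measure. \<phi> z = \<psi> z"
  shows "mult_L2 \<phi> f = mult_L2 \<psi> f"
proof (cases f)
  case (1 f')
  show ?thesis
    unfolding 1 mult_L2_abs[OF assms(1) 1(2)] mult_L2_abs[OF assms(2) 1(2)]
    by (rule abs_L2_eqI) (use assms 1 in \<open>auto simp: mult_sq_integrable elim: eventually_mono\<close>)
qed

lemma mult_L2_const: "mult_L2 (\<lambda>_. c) f = c *\<^sub>C f"
  by (cases f) (simp add: mult_L2_abs scaleC_abs_L2)

lemma mult_L2_diff_symbol:
  assumes "ess_bounded \<phi>" "ess_bounded \<psi>"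
  shows "mult_L2 (\<lambda>z. \<phi> z - \<psi> z) f = mult_L2 \<phi> f - mult_L2 \<psi> f"
  by (cases f) (simp add: assms mult_L2_abs ess_bounded_diff minus_abs_L2 mult_sq_integrable left_diff_distrib)

lemma cinner_mult_L2:
  assumes "ess_bounded \<phi>"
  shows "cinner (mult_L2 \<phi> f) g = cinner f (mult_L2 (\<lambda>z. cnj (\<phi> z)) g)"
  by (cases f; cases g)
     (simp add: assms mult_L2_abs ess_bounded_cnj cinner_abs_L2 mult_sq_integrable, simp add: mult_ac)

lemma bounded_linear_mult_L2:
  assumes "ess_bounded \<phi>" shows "bounded_linear (mult_L2 \<phi>)"
proof -
  obtain C where C: "AE z in circle_measure. cmod (\<phi> z) \<le> C" and m: "\<phi> \<in> borel_measurable circle_measure"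
    using assms by (auto simp: ess_bounded_def)
  have C': "AE z in circle_measure. cmod (\<phi> z) \<le> \<bar>C\<bar>"
    using C by eventually_elim linarith
  have "norm (mult_L2 \<phi> f) \<le> norm f * \<bar>C\<bar>" for f
    by (cases f) (use mult_sq_integrable_bound(2)[OF m C'] in \<open>simp add: assms mult_L2_abs mult.commute\<close>)
  then show ?thesis
    by (intro bounded_linear_intro[of _ "\<bar>C\<bar>"])
       (simp_all add: assms mult_L2_add scaleC_of_real[symmetric] mult_L2_scaleC)
qed

lemma mult_L2_unimodular_cancel:
  assumes "ess_bounded \<phi>" "AE z in circle_measure. cmod (\<phi> z) = 1"
  shows "mult_L2 (\<lambda>z. cnj (\<phi> z)) (mult_L2 \<phi> f) = f" "mult_L2 \<phi> (mult_L2 (\<lambda>z. cnj (\<phi> z)) f) = f"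
proof -
  have *: "mult_L2 (\<lambda>_. 1) f = f" by (simp add: mult_L2_const scaleC_algebra)
  have "AE z in circle_measure. cnj (\<phi> z) * \<phi> z = 1" "AE z in circle_measure. \<phi> z * cnj (\<phi> z) = 1"
    using assms(2) by (eventually_elim, simp add: complex_norm_square[symmetric] mult.commute[of "cnj _"])+
  note ae = this
  have "mult_L2 (\<lambda>z. cnj (\<phi> z) * \<phi> z) f = mult_L2 (\<lambda>_. 1) f"
    by (intro mult_L2_cong ess_bounded_mult ess_bounded_cnj assms(1) ess_bounded_const ae)
  moreover have "mult_L2 (\<lambda>z. \<phi> z * cnj (\<phi> z)) f = mult_L2 (\<lambda>_. 1) f"
    by (intro mult_L2_cong ess_bounded_mult ess_bounded_cnj assms(1) ess_bounded_const ae)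
  ultimately show "mult_L2 (\<lambda>z. cnj (\<phi> z)) (mult_L2 \<phi> f) = f" "mult_L2 \<phi> (mult_L2 (\<lambda>z. cnj (\<phi> z)) f) = f"
    by (simp_all add: * mult_L2_mult assms ess_bounded_cnj)
qed

section \<open>Completeness and orthonormal sequences\<close>

text \<open>The heart of the Riesz-Fischer theorem.  By monotone convergence the sum of the \<open>cmod (f k)\<close> is
  square-integrable, hence finite almost everywhere; it dominates the remainders of the pointwise sum of the
  \<open>f k\<close>, so that dominated convergence turns pointwise into mean convergence.\<close>

lemma L2_absolutely_summable:
  fixes x :: "nat \<Rightarrow> L2_circle"
  assumes "summable (\<lambda>n. norm (x n))"
  shows "summable x"
proof -
  define B where "B = (\<Sum>n. norm (x n))"
  define f where "f n = rep_L2 (x n)" for n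
  have f [simp]: "f n \<in> sq_integrable" and x: "x n = abs_L2 (f n)" for n
    by (simp_all add: f_def)
  have [measurable]: "f n \<in> borel_measurable circle_measure" for n
    using f[of n] by (simp add: sq_integrable_def)
  define g where "g n z = (\<Sum>k<n. cmod (f k z))" for n z
  have [measurable]: "g n \<in> borel_measurable circle_measure" for n
    unfolding g_def by measurable
  have g_mono: "g m z \<le> g n z" if "m \<le> n" for m n z
    unfolding g_def by (rule sum_mono2) (use that in auto)
  have g_nonneg: "0 \<le> g n z" for n z
    unfolding g_def by (rule sum_nonneg) auto
  have abs_f: "(\<lambda>z. complex_of_real (cmod (f n z))) \<in> sq_integrable" for n
    using f[of n] by (simp add: sq_integrable_def)
  have g_L2: "(\<lambda>z. complex_of_real (g n z)) \<in> sq_integrable \<and>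
      norm (abs_L2 (\<lambda>z. complex_of_real (g n z))) \<le> (\<Sum>k<n. norm (x k))" for n
  proof (induction n)
    case 0
    have "abs_L2 (\<lambda>_. 0) = 0" by (simp add: zero_L2_circle.abs_eq)
    then show ?case by (simp add: g_def zero_sq_integrable)
  next
    case (Suc n)
    have n: "norm (abs_L2 (\<lambda>z. complex_of_real (cmod (f n z)))) = norm (x n)"
      by (rule power2_eq_imp_eq) (simp_all add: x norm_abs_L2 abs_f)
    have eq: "(\<lambda>z. complex_of_real (g (Suc n) z)) = (\<lambda>z. complex_of_real (g n z) + of_real (cmod (f n z)))"
      by (simp add: g_def)
    have "norm (abs_L2 (\<lambda>z. complex_of_real (g (Suc n) z))) \<le>
       norm (abs_L2 (\<lambda>z. complex_of_real (g n z))) + norm (abs_L2 (\<lambda>z. complex_of_real (cmod (f n z))))"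
      unfolding eq using Suc abs_f by (simp add: plus_abs_L2[symmetric] norm_triangle_ineq)
    then show ?case unfolding eq using Suc abs_f n by (auto intro: add_sq_integrable)
  qed
  define G where "G z = (SUP n. ennreal ((g n z)\<^sup>2))" for z
  have [measurable]: "G \<in> borel_measurable circle_measure"
    unfolding G_def by measurable
  have "(\<integral>\<^sup>+z. G z \<partial>circle_measure) = (SUP n. (\<integral>\<^sup>+z. ennreal ((g n z)\<^sup>2) \<partial>circle_measure))"
    unfolding G_def
    by (rule nn_integral_monotone_convergence_SUP)
       (auto simp: incseq_def le_fun_def intro!: ennreal_leI power_mono g_mono g_nonneg)
  also have "\<dots> \<le> ennreal (B\<^sup>2)"
  proof (rule SUP_least)
    fix n
    have i: "integrable circle_measure (\<lambda>z. (g n z)\<^sup>2)"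
      using g_L2[of n] by (simp add: sq_integrable_def)
    have "norm (abs_L2 (\<lambda>z. complex_of_real (g n z))) \<le> B"
      using g_L2[of n] sum_le_suminf[OF assms, of "{..<n}"] by (simp add: B_def)
    then have "(\<integral>z. (g n z)\<^sup>2 \<partial>circle_measure) \<le> B\<^sup>2"
      using power_mono[of _ B 2] norm_abs_L2[of "\<lambda>z. complex_of_real (g n z)"] g_L2[of n] by fastforce
    then show "(\<integral>\<^sup>+z. ennreal ((g n z)\<^sup>2) \<partial>circle_measure) \<le> ennreal (B\<^sup>2)"
      by (subst nn_integral_eq_integral[OF i]) (auto intro: ennreal_leI)
  qed
  finally have G_int: "(\<integral>\<^sup>+z. G z \<partial>circle_measure) < \<infinity>"
    using le_less_trans by fastforce
  then have G_fin: "AE z in circle_measure. G z \<noteq> \<infinity>"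
    by (intro nn_integral_PInf_AE) auto
  \<comment> \<open>the integrable majorant of the squared remainders\<close>
  define w where "w z = enn2real (G z)" for z
  have [measurable]: "w \<in> borel_measurable circle_measure"
    unfolding w_def by measurable
  have "(\<integral>\<^sup>+z. ennreal (w z) \<partial>circle_measure) = (\<integral>\<^sup>+z. G z \<partial>circle_measure)"
    by (rule nn_integral_cong_AE) (use G_fin in \<open>auto simp: w_def less_top intro!: ennreal_enn2real\<close>)
  then have w_int: "integrable circle_measure w"
    using G_int by (intro integrableI_bounded) (auto simp: w_def)
  have g_w: "g n z \<le> sqrt (w z)" if "G z \<noteq> \<infinity>" for n z
  proof (rule real_le_rsqrt)
    have "ennreal ((g n z)\<^sup>2) \<le> G z" unfolding G_def by (rule SUP_upper) simp
    then have "enn2real (ennreal ((g n z)\<^sup>2)) \<le> w z"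
      unfolding w_def using that by (intro enn2real_mono) (auto simp: less_top)
    then show "(g n z)\<^sup>2 \<le> w z" by simp
  qed
  define s where "s z = (\<Sum>n. f n z)" for z
  have [measurable]: "s \<in> borel_measurable circle_measure"
    unfolding s_def by measurable
  have sm: "summable (\<lambda>n. cmod (f n z))" if "G z \<noteq> \<infinity>" for z
    by (rule summableI_nonneg_bounded[of _ "sqrt (w z)"]) (use g_w[OF that] in \<open>auto simp: g_def\<close>)
  have lim: "(\<lambda>n. \<Sum>k<n. f k z) \<longlonglongrightarrow> s z" if "G z \<noteq> \<infinity>" for z
    unfolding s_def using summable_norm_cancel[OF sm[OF that]] by (rule summable_LIMSEQ)
  have le: "cmod (s z - (\<Sum>k<n. f k z)) \<le> sqrt (w z)" if "G z \<noteq> \<infinity>" for n z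
  proof (rule LIMSEQ_le_const2)
    show "(\<lambda>m. cmod ((\<Sum>k<m. f k z) - (\<Sum>k<n. f k z))) \<longlonglongrightarrow> cmod (s z - (\<Sum>k<n. f k z))"
      by (intro tendsto_intros lim that)
    have "cmod ((\<Sum>k<m. f k z) - (\<Sum>k<n. f k z)) \<le> sqrt (w z)" if "m \<ge> n" for m
    proof -
      have "(\<Sum>k<m. f k z) - (\<Sum>k<n. f k z) = (\<Sum>k\<in>{n..<m}. f k z)"
        using that sum_diff_nat_ivl[of 0 n m "\<lambda>k. f k z"] by (simp add: atLeast0LessThan)
      also have "cmod \<dots> \<le> (\<Sum>k\<in>{n..<m}. cmod (f k z))" by (rule norm_sum)
      also have "\<dots> \<le> g m z" unfolding g_def by (rule sum_mono2) auto
      finally show ?thesis using g_w[OF \<open>G z \<noteq> \<infinity>\<close>, of m] by simp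
    qed
    then show "\<exists>N. \<forall>m\<ge>N. cmod ((\<Sum>k<m. f k z) - (\<Sum>k<n. f k z)) \<le> sqrt (w z)" by blast
  qed
  have sq: "(cmod a)\<^sup>2 \<le> w z" if "cmod a \<le> sqrt (w z)" for a z
    using power_mono[OF that, of 2] by (simp add: w_def)
  have "integrable circle_measure (\<lambda>z. (cmod (s z))\<^sup>2)"
  proof (rule Bochner_Integration.integrable_bound[OF w_int])
    show "AE z in circle_measure. norm ((cmod (s z))\<^sup>2) \<le> norm (w z)"
      using G_fin
    proof eventually_elim
      case (elim z)
      then show ?case using sq[OF le[of z 0]] by (simp add: w_def)
    qed
  qed measurable
  then have s_sq: "s \<in> sq_integrable" by (simp add: sq_integrable_def)
  have S_L2: "(\<lambda>z. \<Sum>k<n. f k z) \<in> sq_integrable \<and> abs_L2 (\<lambda>z. \<Sum>k<n. f k z) = (\<Sum>k<n. x k)" for n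
  proof (induction n)
    case 0
    show ?case by (simp add: zero_L2_circle.abs_eq zero_sq_integrable)
  next
    case (Suc n)
    then show ?case by (auto simp: plus_abs_L2[symmetric] x intro!: add_sq_integrable)
  qed
  have "(\<lambda>n. \<integral>z. (cmod (s z - (\<Sum>k<n. f k z)))\<^sup>2 \<partial>circle_measure) \<longlonglongrightarrow> (\<integral>z. 0 \<partial>circle_measure)"
  proof (rule integral_dominated_convergence[OF _ _ w_int])
    show "AE z in circle_measure. (\<lambda>n. (cmod (s z - (\<Sum>k<n. f k z)))\<^sup>2) \<longlonglongrightarrow> 0"
      using G_fin
    proof eventually_elim
      case (elim z)
      have "(\<lambda>n. (cmod (s z - (\<Sum>k<n. f k z)))\<^sup>2) \<longlonglongrightarrow> (cmod (s z - s z))\<^sup>2"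
        by (intro tendsto_intros lim elim)
      then show ?case by simp
    qed
    show "AE z in circle_measure. norm ((cmod (s z - (\<Sum>k<n. f k z)))\<^sup>2) \<le> w z" for n
      using G_fin by eventually_elim (use sq le in simp)
  qed measurable
  then have "(\<lambda>n. (norm (abs_L2 s - (\<Sum>k<n. x k)))\<^sup>2) \<longlonglongrightarrow> 0"
    by (simp add: S_L2[THEN conjunct2, symmetric] S_L2[THEN conjunct1] s_sq minus_abs_L2 norm_abs_L2
        diff_sq_integrable)
  then have "(\<lambda>n. norm (abs_L2 s - (\<Sum>k<n. x k))) \<longlonglongrightarrow> 0"
    using tendsto_real_sqrt by fastforce
  then have "(\<lambda>n. abs_L2 s - (\<Sum>k<n. x k)) \<longlonglongrightarrow> 0"
    by (rule tendsto_norm_zero_cancel)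
  from tendsto_diff[OF tendsto_const this, of "abs_L2 s"]
  have "(\<lambda>n. \<Sum>k<n. x k) \<longlonglongrightarrow> abs_L2 s" by simp
  then show "summable x" by (auto simp: summable_def sums_def)
qed

text \<open>A Cauchy sequence has a subsequence with geometrically decreasing steps, whose telescoping series
  is absolutely summable.\<close>

instance L2_circle :: banach
proof
  fix X :: "nat \<Rightarrow> L2_circle"
  assume X: "Cauchy X"
  have "\<exists>M. \<forall>m\<ge>M. \<forall>n\<ge>M. norm (X m - X n) < (1/2) ^ k" for k
    using CauchyD[OF X, of "(1/2) ^ k"] by simp
  then obtain M where M: "\<And>k m n. \<lbrakk>m \<ge> M k; n \<ge> M k\<rbrakk> \<Longrightarrow> norm (X m - X n) < (1/2) ^ k"
    by metis
  define r where "r n = (\<Sum>k\<le>n. Suc (M k))" for n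
  have r: "strict_mono r" by (rule strict_monoI_Suc) (simp add: r_def)
  have r_ge: "M n \<le> r n" for n
    unfolding r_def using member_le_sum[of n "{..n}" "\<lambda>k. Suc (M k)"] by simp
  have "norm (X (r (Suc n)) - X (r n)) \<le> (1/2) ^ n" for n
    using M[OF _ r_ge[of n], of "r (Suc n)"] r_ge[of n] strict_mono_less_eq[OF r, of n "Suc n"]
    by (intro less_imp_le) auto
  then have "summable (\<lambda>n. norm (X (r (Suc n)) - X (r n)))"
    by (intro summable_comparison_test[OF _ summable_geometric[of "1/2::real"]]) auto
  then have "summable (\<lambda>n. X (r (Suc n)) - X (r n))"
    by (rule L2_absolutely_summable)
  then obtain l where "(\<lambda>n. \<Sum>k<n. X (r (Suc k)) - X (r k)) \<longlonglongrightarrow> l"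
    by (auto simp: summable_def sums_def)
  then have "(\<lambda>n. X (r n) - X (r 0)) \<longlonglongrightarrow> l"
    by (simp add: sum_lessThan_telescope[of "\<lambda>n. X (r n)"])
  then have "(\<lambda>n. (X (r n) - X (r 0)) + X (r 0)) \<longlonglongrightarrow> l + X (r 0)"
    by (intro tendsto_intros)
  then have "(X \<circ> r) \<longlonglongrightarrow> l + X (r 0)" by (simp add: o_def)
  then show "convergent X"
    using Cauchy_converges_subseq[OF X r] by (auto simp: convergent_def)
qed

definition orthonormal_seq :: "(nat \<Rightarrow> L2_circle) \<Rightarrow> bool" where
  "orthonormal_seq v \<longleftrightarrow> (\<forall>m n. cinner (v m) (v n) = of_bool (m = n))"

lemma orthonormal_seqD: "orthonormal_seq v \<Longrightarrow> cinner (v m) (v n) = of_bool (m = n)"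
  by (simp add: orthonormal_seq_def)

lemma norm_add_orthogonal:
  assumes "cinner f g = 0" shows "(norm (f + g))\<^sup>2 = (norm f)\<^sup>2 + (norm g)\<^sup>2"
proof -
  have "cinner g f = 0" using assms by (simp add: cinner_eq_0_commute)
  then show ?thesis
    using assms by (simp add: power2_norm_eq_inner inner_L2_circle_def cinner_add_left cinner_add_right)
qed

lemma norm_orthonormal_sum:
  assumes "orthonormal_seq v" "finite A"
  shows "(norm (\<Sum>n\<in>A. c n *\<^sub>C v n))\<^sup>2 = (\<Sum>n\<in>A. (cmod (c n))\<^sup>2)"
  using assms(2)
proof (induction A)
  case (insert n A)
  have "complex_of_real ((norm (v n))\<^sup>2) = 1"
    using orthonormal_seqD[OF assms(1), of n n] unfolding cinner_self by simp
  then have "norm (v n) = 1"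
    by (intro power2_eq_imp_eq[of _ 1]) (auto simp del: of_real_power)
  moreover have "cinner (c n *\<^sub>C v n) (\<Sum>m\<in>A. c m *\<^sub>C v m) = 0"
    using insert(2)
    by (subst cinner_eq_0_commute, unfold cinner_sum_left)
       (auto intro!: sum.neutral simp: cinner_scaleC_left cinner_scaleC_right orthonormal_seqD[OF assms(1)])
  ultimately show ?case
    using insert by (simp add: norm_add_orthogonal power_mult_distrib)
qed simp

lemma cinner_orthonormal_sum:
  assumes "orthonormal_seq v" "finite A"
  shows "cinner (\<Sum>n\<in>A. c n *\<^sub>C v n) (v m) = (if m \<in> A then c m else 0)"
  by (simp add: cinner_sum_left cinner_scaleC_left orthonormal_seqD[OF assms(1)] assms(2) if_distrib
      sum.delta cong: if_cong)

lemma Bessel: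
  assumes "orthonormal_seq v" "finite A"
  shows "(\<Sum>n\<in>A. (cmod (cinner f (v n)))\<^sup>2) \<le> (norm f)\<^sup>2"
proof -
  define p where "p = (\<Sum>n\<in>A. cinner f (v n) *\<^sub>C v n)"
  have "cinner (f - p) (v n) = 0" if "n \<in> A" for n
    using that by (simp add: cinner_diff_left p_def cinner_orthonormal_sum[OF assms])
  then have "cinner (v n) (f - p) = 0" if "n \<in> A" for n
    using that cinner_eq_0_commute by blast
  then have "cinner p (f - p) = 0"
    unfolding p_def cinner_sum_left cinner_scaleC_left by (intro sum.neutral) (simp add: p_def)
  then have "(norm f)\<^sup>2 = (norm p)\<^sup>2 + (norm (f - p))\<^sup>2"
    using norm_add_orthogonal[of p "f - p"] by simp
  then show ?thesis by (simp add: p_def norm_orthonormal_sum[OF assms])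
qed

lemma Bessel_summable:
  assumes "orthonormal_seq v" shows "summable (\<lambda>n. (cmod (cinner f (v n)))\<^sup>2)"
  by (rule summableI_nonneg_bounded[of _ "(norm f)\<^sup>2"]) (auto intro: Bessel[OF assms])

text \<open>Coefficients along an orthonormal sequence tend to zero, so they cannot have constant
  nonzero modulus; this is how eigenvectors for unimodular eigenvalues are ruled out.\<close>

lemma orthonormal_coeff_const_modulus:
  assumes "orthonormal_seq v" "\<And>n. cmod (cinner f (v (Suc n))) = cmod (cinner f (v n))"
  shows "cinner f (v n) = 0"
proof -
  have *: "cmod (cinner f (v n)) = cmod (cinner f (v 0))" for n
    by (induction n) (use assms(2) in auto)
  have "(\<lambda>n. (cmod (cinner f (v n)))\<^sup>2) \<longlonglongrightarrow> 0"
    by (rule summable_LIMSEQ_zero[OF Bessel_summable[OF assms(1)]])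
  moreover have "(\<lambda>n. (cmod (cinner f (v n)))\<^sup>2) = (\<lambda>n. (cmod (cinner f (v 0)))\<^sup>2)"
    by (rule ext) (rule arg_cong[where f = "\<lambda>x. x\<^sup>2", OF *])
  ultimately have "(cmod (cinner f (v 0)))\<^sup>2 = 0"
    by (simp add: LIMSEQ_const_iff)
  then show ?thesis using *[of n] by simp
qed

lemma orthonormal_series_summable:
  assumes v: "orthonormal_seq v" shows "summable (\<lambda>n. cinner f (v n) *\<^sub>C v n)"
  unfolding summable_Cauchy
proof (intro allI impI)
  fix e :: real assume "e > 0"
  then have "e\<^sup>2 > 0" by simp
  then obtain N where N: "\<And>m n. m \<ge> N \<Longrightarrow> norm (\<Sum>k=m..<n. (cmod (cinner f (v k)))\<^sup>2) < e\<^sup>2"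
    using Bessel_summable[OF v, of f] unfolding summable_Cauchy by blast
  have "norm (\<Sum>k=m..<n. cinner f (v k) *\<^sub>C v k) < e" if "m \<ge> N" for m n
    using N[OF that, of n] \<open>e > 0\<close>
    by (intro power2_less_imp_less[of _ e]) (auto simp: norm_orthonormal_sum[OF v])
  then show "\<exists>N. \<forall>m\<ge>N. \<forall>n. norm (\<Sum>k=m..<n. cinner f (v k) *\<^sub>C v k) < e" by blast
qed

section \<open>The Hardy space as a space of boundary functions\<close>

definition one_L2 :: L2_circle where
  "one_L2 = abs_L2 (\<lambda>_. 1)"

lemma const_sq_integrable [simp]: "(\<lambda>_. c) \<in> sq_integrable"
  by (simp add: sq_integrable_def)

lemma mult_L2_one: "ess_bounded \<phi> \<Longrightarrow> mult_L2 \<phi> one_L2 = abs_L2 \<phi>"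
  by (simp add: one_L2_def mult_L2_abs)

lemma ess_bounded_sq_integrable: "ess_bounded \<phi> \<Longrightarrow> \<phi> \<in> sq_integrable"
  using mult_sq_integrable[of \<phi> "\<lambda>_. 1"] by simp

lemma cinner_one_one: "cinner one_L2 one_L2 = 1"
  by (simp add: one_L2_def cinner_abs_L2 circle.prob_space[unfolded space_circle_measure])

lemma norm_abs_L2_le:
  assumes "\<phi> \<in> borel_measurable circle_measure" "\<And>z. cmod z = 1 \<Longrightarrow> cmod (\<phi> z) \<le> C" "0 \<le> C"
  shows "norm (abs_L2 \<phi>) \<le> C"
proof -
  have "AE z in circle_measure. cmod (\<phi> z) \<le> C"
    using AE_circle_norm by eventually_elim (rule assms(2))
  from mult_sq_integrable_bound(2)[OF assms(1) this, of "\<lambda>_. 1"] assms(3)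
  have "norm (abs_L2 \<phi>) \<le> C * norm one_L2" by (simp add: one_L2_def)
  also have "norm one_L2 = 1"
    using cinner_one_one unfolding cinner_self by (simp del: of_real_power add: power2_eq_1_iff) (smt (verit) norm_ge_zero)
  finally show ?thesis by simp
qed

text \<open>Multiplication by \<open>u\<close> is unitary, so powers of \<open>u\<close> can be cancelled and only the products
  with \<open>e\<close> itself remain.\<close>

lemma orthonormal_powers:
  assumes u: "ess_bounded u" "AE z in circle_measure. cmod (u z) = 1"
    and e: "cinner e e = 1" "\<And>n. n > 0 \<Longrightarrow> cinner (mult_L2 (\<lambda>z. u z ^ n) e) e = 0"
  shows "orthonormal_seq (\<lambda>n. mult_L2 (\<lambda>z. u z ^ n) e)"
proof -
  have bp: "ess_bounded (\<lambda>z. u z ^ n)" for n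
    by (induction n) (simp_all add: ess_bounded_mult u(1))
  have up: "AE z in circle_measure. cmod (u z ^ n) = 1" for n
    using u(2) by eventually_elim (simp add: norm_power)
  have *: "cinner (mult_L2 (\<lambda>z. u z ^ (n + k)) e) (mult_L2 (\<lambda>z. u z ^ n) e) = of_bool (k = 0)" for n k
  proof -
    have "mult_L2 (\<lambda>z. u z ^ (n + k)) e = mult_L2 (\<lambda>z. u z ^ n) (mult_L2 (\<lambda>z. u z ^ k) e)"
      by (simp add: mult_L2_mult bp power_add)
    then have "cinner (mult_L2 (\<lambda>z. u z ^ (n + k)) e) (mult_L2 (\<lambda>z. u z ^ n) e)
       = cinner (mult_L2 (\<lambda>z. u z ^ k) e) (mult_L2 (\<lambda>z. cnj (u z ^ n)) (mult_L2 (\<lambda>z. u z ^ n) e))"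
      by (simp only: cinner_mult_L2 bp)
    also have "\<dots> = cinner (mult_L2 (\<lambda>z. u z ^ k) e) e"
      by (simp only: mult_L2_unimodular_cancel(1)[OF bp up])
    also have "\<dots> = of_bool (k = 0)"
      using e by (cases "k = 0") (auto simp: mult_L2_const scaleC_algebra)
    finally show ?thesis .
  qed
  have "cinner (mult_L2 (\<lambda>z. u z ^ m) e) (mult_L2 (\<lambda>z. u z ^ n) e) = of_bool (m = n)" for m n
  proof (cases "n \<le> m")
    case True
    then show ?thesis using *[of n "m - n"] by (auto simp: of_bool_def)
  next
    case False
    then have "cinner (mult_L2 (\<lambda>z. u z ^ n) e) (mult_L2 (\<lambda>z. u z ^ m) e) = 0"
      using *[of m "n - m"] by auto
    then have "cinner (mult_L2 (\<lambda>z. u z ^ m) e) (mult_L2 (\<lambda>z. u z ^ n) e) = 0"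
      by (simp only: cinner_eq_0_commute)
    then show ?thesis using False by simp
  qed
  then show ?thesis by (simp add: orthonormal_seq_def)
qed

definition zmon :: "nat \<Rightarrow> L2_circle" where
  "zmon n = abs_L2 (\<lambda>z. z ^ n)"

lemma zmon_0: "zmon 0 = one_L2"
  by (simp add: zmon_def one_L2_def)

lemma zmon_eq_mult: "zmon n = mult_L2 (\<lambda>z. z ^ n) one_L2"
  by (simp add: zmon_def mult_L2_one)

lemma mult_id_zmon: "mult_L2 (\<lambda>z. z) (zmon n) = zmon (Suc n)"
  by (simp add: zmon_eq_mult mult_L2_mult)

lemma cinner_power_one: "n > 0 \<Longrightarrow> cinner (mult_L2 (\<lambda>z. z ^ n) one_L2) one_L2 = 0"
  by (simp add: mult_L2_one) (simp add: one_L2_def cinner_abs_L2 ess_bounded_sq_integrable integral_power_circle)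

lemma orthonormal_zmon: "orthonormal_seq zmon"
  using orthonormal_powers[of "\<lambda>z. z" one_L2] AE_circle_norm cinner_one_one cinner_power_one
  by (simp add: zmon_eq_mult[abs_def])

text \<open>The closed span of the monomials appears as a double orthogonal complement.  In this form
  membership is tested by inner products, so that invariance under a multiplication operator
  reduces to invariance of the coanalytic functions under its adjoint.\<close>

definition coanalytic :: "L2_circle set" where
  "coanalytic = orth (range zmon)"

definition analytic :: "L2_circle set" where
  "analytic = orth coanalytic"

lemma coanalytic_iff: "f \<in> coanalytic \<longleftrightarrow> (\<forall>n. cinner f (zmon n) = 0)"
  by (simp add: coanalytic_def orth_def)

lemma analytic_iff: "f \<in> analytic \<longleftrightarrow> (\<forall>g\<in>coanalytic. cinner f g = 0)"
  by (simp add: analytic_def orth_def)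

lemma analytic_coanalytic_orth: "\<lbrakk>f \<in> analytic; g \<in> coanalytic\<rbrakk> \<Longrightarrow> cinner f g = 0 \<and> cinner g f = 0"
  by (auto simp: analytic_iff cinner_eq_0_commute[of g f])

lemma zmon_analytic: "zmon n \<in> analytic"
  by (auto simp: analytic_iff coanalytic_iff cinner_eq_0_commute[of "zmon n"])

lemma closed_analytic: "closed analytic"
  unfolding analytic_def by (rule closed_orth)

lemma sum_zmon_analytic: "(\<Sum>n\<in>A. c n *\<^sub>C zmon n) \<in> analytic"
  using zmon_analytic
  by (simp add: analytic_iff cinner_sum_left cinner_scaleC_left)

text \<open>The Fourier series with indices \<open>n \<ge> 0\<close>; completeness makes it converge, so this is the orthogonal
  projection onto the analytic functions.\<close>

definition analytic_part :: "L2_circle \<Rightarrow> L2_circle" where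
  "analytic_part f = (\<Sum>n. cinner f (zmon n) *\<^sub>C zmon n)"

lemma analytic_part_LIMSEQ: "(\<lambda>N. \<Sum>n<N. cinner f (zmon n) *\<^sub>C zmon n) \<longlonglongrightarrow> analytic_part f"
  unfolding analytic_part_def
  by (rule summable_LIMSEQ[OF orthonormal_series_summable[OF orthonormal_zmon]])

lemma analytic_part_in: "analytic_part f \<in> analytic"
  by (rule Lim_in_closed_set[OF closed_analytic _ _ analytic_part_LIMSEQ]) (simp_all add: sum_zmon_analytic)

lemma coanalytic_part_in: "f - analytic_part f \<in> coanalytic"
  unfolding coanalytic_iff
proof
  fix m
  have "(\<lambda>N. cinner (\<Sum>n<N. cinner f (zmon n) *\<^sub>C zmon n) (zmon m)) \<longlonglongrightarrow> cinner (analytic_part f) (zmon m)"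
    by (rule tendsto_cinner_left[OF analytic_part_LIMSEQ])
  moreover have "\<forall>\<^sub>F N in sequentially. cinner (\<Sum>n<N. cinner f (zmon n) *\<^sub>C zmon n) (zmon m) = cinner f (zmon m)"
    using eventually_gt_at_top[of m] by eventually_elim (simp add: cinner_orthonormal_sum[OF orthonormal_zmon])
  ultimately have "cinner (analytic_part f) (zmon m) = cinner f (zmon m)"
    by (blast intro: LIMSEQ_unique tendsto_eventually)
  then show "cinner (f - analytic_part f) (zmon m) = 0" by (simp add: cinner_diff_left)
qed

lemma analytic_part_eqI:
  assumes "g \<in> analytic" "f - g \<in> coanalytic" shows "analytic_part f = g"
proof -
  have "analytic_part f - g \<in> analytic"
    using assms analytic_part_in unfolding analytic_def by (blast intro: orth_diff)
  moreover have "analytic_part f - g \<in> coanalytic"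
    using orth_diff[OF assms(2)[unfolded coanalytic_def] coanalytic_part_in[of f, unfolded coanalytic_def]]
    by (simp add: coanalytic_def)
  ultimately have "cinner (analytic_part f - g) (analytic_part f - g) = 0"
    using analytic_coanalytic_orth by blast
  then show ?thesis by (simp add: cinner_self)
qed

lemma analytic_part_analytic: "f \<in> analytic \<Longrightarrow> analytic_part f = f"
  by (rule analytic_part_eqI) (auto simp: coanalytic_iff)

text \<open>The series converges uniformly on the circle, and the norm is at most the supremum.\<close>

lemma power_series_L2:
  assumes "summable (\<lambda>n. cmod (b n))"
  shows "(\<lambda>z. \<Sum>n. b n * z ^ n) \<in> borel_measurable circle_measure"
    and "(\<lambda>N. \<Sum>n<N. b n *\<^sub>C zmon n) \<longlonglongrightarrow> abs_L2 (\<lambda>z. \<Sum>n. b n * z ^ n)"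
proof -
  let ?F = "\<lambda>z. \<Sum>n. b n * z ^ n"
  have m: "(\<lambda>z. b n * z ^ n) \<in> borel_measurable circle_measure" for n
    by (rule borel_measurable_circle_borel) simp
  then show mF: "?F \<in> borel_measurable circle_measure"
    by (rule borel_measurable_suminf)
  have mS: "(\<lambda>z. \<Sum>n<N. b n * z ^ n) \<in> borel_measurable circle_measure" for N
    using m by (rule borel_measurable_sum)
  have S: "(\<lambda>z. \<Sum>n<N. b n * z ^ n) \<in> sq_integrable \<and>
      abs_L2 (\<lambda>z. \<Sum>n<N. b n * z ^ n) = (\<Sum>n<N. b n *\<^sub>C zmon n)" for N
  proof (induction N)
    case 0
    show ?case by (simp add: zero_L2_circle.abs_eq zero_sq_integrable)
  next
    case (Suc N)
    have "(\<lambda>z. b N * z ^ N) \<in> sq_integrable" "abs_L2 (\<lambda>z. b N * z ^ N) = b N *\<^sub>C zmon N"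
      by (simp_all add: zmon_def scaleC_abs_L2 ess_bounded_sq_integrable scale_sq_integrable)
    then show ?case using Suc
      by (simp add: plus_abs_L2[symmetric] add_sq_integrable)
  qed
  \<comment> \<open>uniform bound for the remainder of the series on the circle\<close>
  define t where "t N = (\<Sum>n. cmod (b (n + N)))" for N
  have t_nonneg: "0 \<le> t N" for N
    unfolding t_def using summable_ignore_initial_segment[OF assms] by (intro suminf_nonneg) auto
  have le: "cmod (?F z - (\<Sum>n<N. b n * z ^ n)) \<le> t N" if "cmod z = 1" for z N
  proof -
    have sn: "summable (\<lambda>n. cmod (b n * z ^ n))"
      using assms that by (simp add: norm_mult norm_power)
    have "?F z - (\<Sum>n<N. b n * z ^ n) = (\<Sum>n. b (n + N) * z ^ (n + N))"
      using suminf_minus_initial_segment[OF summable_norm_cancel[OF sn], of N] by simp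
    also have "cmod \<dots> \<le> (\<Sum>n. cmod (b (n + N) * z ^ (n + N)))"
      using summable_ignore_initial_segment[OF sn] by (intro summable_norm)
    finally show ?thesis using that by (simp add: t_def norm_mult norm_power)
  qed
  have F: "?F \<in> sq_integrable"
  proof (rule ess_bounded_sq_integrable)
    have "AE z in circle_measure. cmod (?F z) \<le> t 0"
      using AE_circle_norm by eventually_elim (use le[of _ 0] in simp)
    then show "ess_bounded ?F" using mF by (auto simp: ess_bounded_def)
  qed
  have bd: "norm (abs_L2 ?F - (\<Sum>n<N. b n *\<^sub>C zmon n)) \<le> t N" for N
  proof -
    have "abs_L2 ?F - (\<Sum>n<N. b n *\<^sub>C zmon n) = abs_L2 (\<lambda>z. ?F z - (\<Sum>n<N. b n * z ^ n))"
      by (simp only: S[of N, THEN conjunct2, symmetric] minus_abs_L2 F S[of N, THEN conjunct1])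
    then show ?thesis
      using norm_abs_L2_le[of "\<lambda>z. ?F z - (\<Sum>n<N. b n * z ^ n)" "t N"] mF mS le t_nonneg by simp
  qed
  have t_lim: "t \<longlonglongrightarrow> 0"
  proof -
    have "(\<lambda>N. (\<Sum>n. cmod (b n)) - (\<Sum>n<N. cmod (b n))) \<longlonglongrightarrow> (\<Sum>n. cmod (b n)) - (\<Sum>n. cmod (b n))"
      by (intro tendsto_intros summable_LIMSEQ assms)
    then show ?thesis
      using suminf_minus_initial_segment[OF assms] by (simp add: t_def[abs_def])
  qed
  have "(\<lambda>N. abs_L2 ?F - (\<Sum>n<N. b n *\<^sub>C zmon n)) \<longlonglongrightarrow> 0"
    by (rule Lim_null_comparison[OF always_eventually[OF allI[OF bd]] t_lim])
  from tendsto_diff[OF tendsto_const this, of "abs_L2 ?F"]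
  show "(\<lambda>N. \<Sum>n<N. b n *\<^sub>C zmon n) \<longlonglongrightarrow> abs_L2 ?F" by simp
qed

lemma dilate_power_series_L2:
  assumes F: "F holomorphic_on ball 0 1" and r: "0 \<le> r" "r < 1"
  defines "a \<equiv> \<lambda>n. (deriv ^^ n) F 0 / fact n"
  shows "summable (\<lambda>n. cmod (a n * of_real r ^ n))"
    and "cmod z = 1 \<Longrightarrow> F (of_real r * z) = (\<Sum>n. a n * of_real r ^ n * z ^ n)"
proof -
  have sums: "(\<lambda>n. a n * w ^ n) sums F w" if "cmod w < 1" for w
    using holomorphic_power_series[OF F, of w] that by (simp add: a_def)
  have "summable (\<lambda>n. a n * of_real ((1 + r) / 2) ^ n)"
    using sums[of "of_real ((1 + r) / 2)"] r by (auto simp: sums_iff simp del: of_real_divide)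
  then show "summable (\<lambda>n. cmod (a n * of_real r ^ n))"
    by (rule powser_insidea) (use r in \<open>simp del: of_real_divide\<close>)
  assume "cmod z = 1"
  then show "F (of_real r * z) = (\<Sum>n. a n * of_real r ^ n * z ^ n)"
    using sums[of "of_real r * z"] r by (simp add: sums_iff norm_mult power_mult_distrib mult.assoc)
qed

text \<open>The Taylor coefficients of a dilate are absolutely summable, so it is a mean limit of polynomials;
  its mean value is its coefficient of index zero.\<close>

lemma dilate_L2:
  assumes F: "F holomorphic_on ball 0 1" and r: "0 \<le> r" "r < 1"
  shows "(\<lambda>z. F (of_real r * z)) \<in> borel_measurable circle_measure"
    and "(\<lambda>z. F (of_real r * z)) \<in> sq_integrable"
    and "abs_L2 (\<lambda>z. F (of_real r * z)) \<in> analytic"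
    and "cinner (abs_L2 (\<lambda>z. F (of_real r * z))) one_L2 = F 0"
proof -
  define b where "b n = (deriv ^^ n) F 0 / fact n * of_real r ^ n" for n
  have sm: "summable (\<lambda>n. cmod (b n))" and eq: "\<And>z. cmod z = 1 \<Longrightarrow> F (of_real r * z) = (\<Sum>n. b n * z ^ n)"
    using dilate_power_series_L2[OF F r] by (simp_all add: b_def)
  show m: "(\<lambda>z. F (of_real r * z)) \<in> borel_measurable circle_measure"
    using power_series_L2(1)[OF sm] by (subst measurable_cong[OF eq]) auto
  have "compact ((\<lambda>z. F (of_real r * z)) ` sphere 0 1)"
    using r by (intro compact_continuous_image continuous_on_compose2[OF holomorphic_on_imp_continuous_on[OF F]]
        continuous_intros) (auto simp: norm_mult)
  from compact_imp_bounded[OF this]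
  obtain C where C: "\<And>z. cmod z = 1 \<Longrightarrow> cmod (F (of_real r * z)) \<le> C"
    unfolding bounded_iff by (metis dist_0_norm imageI mem_sphere)
  have "AE z in circle_measure. cmod (F (of_real r * z)) \<le> C"
    using AE_circle_norm by eventually_elim (rule C)
  then show sq: "(\<lambda>z. F (of_real r * z)) \<in> sq_integrable"
    using m by (intro ess_bounded_sq_integrable) (auto simp: ess_bounded_def)
  have lim: "(\<lambda>N. \<Sum>n<N. b n *\<^sub>C zmon n) \<longlonglongrightarrow> abs_L2 (\<lambda>z. F (of_real r * z))"
  proof -
    have "abs_L2 (\<lambda>z. \<Sum>n. b n * z ^ n) = abs_L2 (\<lambda>z. F (of_real r * z))"
    proof (rule abs_L2_eqI[OF _ sq])
      show "AE z in circle_measure. (\<Sum>n. b n * z ^ n) = F (of_real r * z)"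
        using AE_circle_norm by eventually_elim (rule eq[symmetric])
      have "integrable circle_measure (\<lambda>z. (cmod (\<Sum>n. b n * z ^ n))\<^sup>2)
          \<longleftrightarrow> integrable circle_measure (\<lambda>z. (cmod (F (of_real r * z)))\<^sup>2)"
        by (rule Bochner_Integration.integrable_cong) (auto simp: eq)
      then show "(\<lambda>z. \<Sum>n. b n * z ^ n) \<in> sq_integrable"
        using sq power_series_L2(1)[OF sm] by (simp add: sq_integrable_def)
    qed
    then show ?thesis using power_series_L2(2)[OF sm] by simp
  qed
  show "abs_L2 (\<lambda>z. F (of_real r * z)) \<in> analytic"
    by (rule Lim_in_closed_set[OF closed_analytic _ _ lim]) (simp_all add: sum_zmon_analytic)
  have "\<forall>\<^sub>F N in sequentially. cinner (\<Sum>n<N. b n *\<^sub>C zmon n) (zmon 0) = F 0"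
    using eventually_gt_at_top[of 0]
    by eventually_elim (simp add: cinner_orthonormal_sum[OF orthonormal_zmon] b_def)
  then show "cinner (abs_L2 (\<lambda>z. F (of_real r * z))) one_L2 = F 0"
    using tendsto_cinner_left[OF lim, of "zmon 0"] unfolding zmon_0
    by (blast intro: LIMSEQ_unique tendsto_eventually)
qed

lemma H2_subset_analytic: "H2 \<subseteq> analytic"
proof
  fix f assume "f \<in> H2"
  then obtain F where F: "F holomorphic_on ball 0 1"
    and lim: "((\<lambda>r. abs_L2 (\<lambda>z. F (of_real r * z))) \<longlongrightarrow> f) (at_left (1::real))"
    unfolding H2_def hardy_H2_disk_def by blast
  have "\<forall>\<^sub>F r in at_left (1::real). r \<in> {0<..<1}"
    by (rule eventually_at_left_real) simp
  then have "\<forall>\<^sub>F r in at_left (1::real). abs_L2 (\<lambda>z. F (of_real r * z)) \<in> analytic"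
    by eventually_elim (use dilate_L2(3)[OF F] in auto)
  then show "f \<in> analytic"
    by (rule Lim_in_closed_set[OF closed_analytic _ _ lim]) simp
qed

text \<open>Dilation by \<open>r\<close> multiplies the \<open>n\<close>-th coefficient by \<open>r ^ n\<close> and hence shrinks every tail.
  Therefore the partial sums approximate all dilates uniformly in \<open>r\<close>, and for a fixed partial sum
  the limit \<open>r \<rightarrow> 1\<close> is clear.\<close>

lemma analytic_subset_H2: "analytic \<subseteq> H2"
proof
  fix f assume f: "f \<in> analytic"
  define c where "c n = cinner f (zmon n)" for n
  define s where "s r N = (\<Sum>n<N. (c n * of_real r ^ n) *\<^sub>C zmon n)" for r :: real and N
  have s1: "s 1 \<longlonglongrightarrow> f"
    using analytic_part_LIMSEQ[of f] analytic_part_analytic[OF f] by (simp add: s_def[abs_def] c_def)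
  have c_le: "cmod (c n) \<le> norm f" for n
  proof (rule power2_le_imp_le)
    show "(cmod (c n))\<^sup>2 \<le> (norm f)\<^sup>2"
      using Bessel[OF orthonormal_zmon, of "{n}" f] by (simp add: c_def)
  qed simp
  have sm: "summable (\<lambda>n. cmod (c n * w ^ n))" if "cmod w < 1" for w
    by (rule summable_comparison_test'[of "\<lambda>n. norm f * cmod w ^ n" 0])
       (use that in \<open>auto intro!: summable_mult summable_geometric mult_right_mono c_le simp: norm_mult norm_power\<close>)
  define F where "F w = (\<Sum>n. c n * w ^ n)" for w
  have hol: "F holomorphic_on ball 0 1"
    by (rule power_series_holomorphic[where a = c])
       (use summable_norm_cancel[OF sm] in \<open>auto simp: F_def intro!: summable_sums\<close>)
  have lim: "s r \<longlonglongrightarrow> abs_L2 (\<lambda>z. F (of_real r * z))" if "0 \<le> r" "r < 1" for r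
    using power_series_L2(2)[of "\<lambda>n. c n * of_real r ^ n"] sm[of "of_real r"] that
    by (simp add: F_def power_mult_distrib s_def[abs_def] mult.assoc)
  have diff_le: "norm (s r M - s r N) \<le> norm (s 1 M - s 1 N)" if "N \<le> M" "0 \<le> r" "r < 1" for r M N
  proof (rule power2_le_imp_le)
    have d: "s r M - s r N = (\<Sum>n=N..<M. (c n * of_real r ^ n) *\<^sub>C zmon n)" for r
      using that(1) sum_diff_nat_ivl[of 0 N M "\<lambda>n. (c n * of_real r ^ n) *\<^sub>C zmon n"]
      by (simp add: s_def atLeast0LessThan)
    have "cmod (c n * of_real r ^ n) \<le> cmod (c n)" for n
      using that power_le_one[of r n] by (simp add: norm_mult norm_power mult_left_le)
    then show "(norm (s r M - s r N))\<^sup>2 \<le> (norm (s 1 M - s 1 N))\<^sup>2"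
      by (simp add: d norm_orthonormal_sum[OF orthonormal_zmon] sum_mono power_mono)
  qed simp
  have dist_le: "norm (abs_L2 (\<lambda>z. F (of_real r * z)) - s r N) \<le> norm (f - s 1 N)" if "0 \<le> r" "r < 1" for r N
  proof (rule LIMSEQ_le)
    show "(\<lambda>M. norm (s r M - s r N)) \<longlonglongrightarrow> norm (abs_L2 (\<lambda>z. F (of_real r * z)) - s r N)"
      by (intro tendsto_intros lim that)
    show "(\<lambda>M. norm (s 1 M - s 1 N)) \<longlonglongrightarrow> norm (f - s 1 N)"
      by (intro tendsto_intros s1)
    show "\<exists>n. \<forall>M\<ge>n. norm (s r M - s r N) \<le> norm (s 1 M - s 1 N)"
      using diff_le that by blast
  qed
  have "(\<integral>z. (cmod (F (of_real r * z)))\<^sup>2 \<partial>circle_measure) \<le> (norm f)\<^sup>2" if "0 \<le> r" "r < 1" for r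
  proof -
    have "(norm (abs_L2 (\<lambda>z. F (of_real r * z))))\<^sup>2 \<le> (norm f)\<^sup>2"
      using dist_le[OF that, of 0] by (intro power_mono) (auto simp: s_def)
    then show ?thesis by (simp add: norm_abs_L2 dilate_L2(2)[OF hol that])
  qed
  then have hardy: "F \<in> hardy_H2_disk"
    using hol unfolding hardy_H2_disk_def by (auto intro!: exI[of _ "(norm f)\<^sup>2"])
  have "((\<lambda>r. abs_L2 (\<lambda>z. F (of_real r * z))) \<longlongrightarrow> f) (at_left (1::real))"
  proof (rule tendstoI)
    fix e :: real assume "e > 0"
    then have "\<forall>\<^sub>F N in sequentially. dist (s 1 N) f < e / 3"
      using tendstoD[OF s1, of "e / 3"] by simp
    then obtain N where N: "norm (f - s 1 N) < e / 3"
      by (auto simp: eventually_sequentially dist_norm norm_minus_commute)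
    \<comment> \<open>continuity in \<open>r\<close> of a polynomial with fixed degree\<close>
    have "((\<lambda>r. \<Sum>n<N. (cmod (c n * of_real r ^ n - c n))\<^sup>2) \<longlongrightarrow> (\<Sum>n<N. (cmod (c n * of_real 1 ^ n - c n))\<^sup>2)) (at_left (1::real))"
      by (intro tendsto_intros)
    moreover have "(\<Sum>n<N. (cmod (c n * of_real r ^ n - c n))\<^sup>2) = (norm (s r N - s 1 N))\<^sup>2" for r
    proof -
      have "s r N - s 1 N = (\<Sum>n<N. (c n * of_real r ^ n - c n) *\<^sub>C zmon n)"
        by (simp add: s_def L2.scale_left_diff_distrib sum_subtractf)
      then show ?thesis by (simp add: norm_orthonormal_sum[OF orthonormal_zmon])
    qed
    ultimately have "((\<lambda>r. norm (s r N - s 1 N)) \<longlongrightarrow> 0) (at_left (1::real))" by simp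
    then have "\<forall>\<^sub>F r in at_left (1::real). norm (s r N - s 1 N) < e / 3"
      by (rule order_tendstoD(2)) (use \<open>e > 0\<close> in simp)
    moreover have "\<forall>\<^sub>F r in at_left (1::real). r \<in> {0<..<1}"
      by (rule eventually_at_left_real) simp
    ultimately show "\<forall>\<^sub>F r in at_left (1::real). dist (abs_L2 (\<lambda>z. F (of_real r * z))) f < e"
    proof eventually_elim
      case (elim r)
      let ?F = "abs_L2 (\<lambda>z. F (of_real r * z))"
      have "norm (?F - s r N) < e / 3"
        using dist_le[of r N] elim N by simp
      moreover have "norm (?F - f) \<le> norm (?F - s r N) + norm (s r N - s 1 N) + norm (s 1 N - f)"
        using norm_triangle_ineq[of "?F - s r N + (s r N - s 1 N)" "s 1 N - f"]
          norm_triangle_ineq[of "?F - s r N" "s r N - s 1 N"] by simp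
      ultimately show ?case using N elim(1) by (simp add: dist_norm norm_minus_commute)
    qed
  qed
  then show "f \<in> H2"
    unfolding H2_def using hardy by blast
qed

theorem H2_eq_analytic: "H2 = analytic"
  using H2_subset_analytic analytic_subset_H2 by blast

section \<open>Radial limits and inner functions\<close>

definition radius_seq :: "nat \<Rightarrow> real" where
  "radius_seq n = 1 - 1 / real (n + 2)"

lemma radius_seq: "0 \<le> radius_seq n" "radius_seq n < 1"
  by (simp_all add: radius_seq_def)

lemma radius_seq_lim: "radius_seq \<longlonglongrightarrow> 1"
proof -
  have "(\<lambda>n. 1 / real (n + 2)) \<longlonglongrightarrow> 0"
    using LIMSEQ_ignore_initial_segment[OF lim_1_over_n, of 2] by simp
  from tendsto_diff[OF tendsto_const this, of 1] show ?thesis by (simp add: radius_seq_def[abs_def])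
qed

lemma radius_seq_left: "filterlim radius_seq (at_left 1) sequentially"
  unfolding filterlim_at using radius_seq_lim radius_seq by (auto intro!: always_eventually simp: less_imp_neq)

lemma le_on_interval_if_rational:
  fixes g :: "real \<Rightarrow> real"
  assumes "continuous_on {a<..<b} g" "\<And>q::rat. of_rat q \<in> {a<..<b} \<Longrightarrow> g (of_rat q) \<le> c" "x \<in> {a<..<b}"
  shows "g x \<le> c"
proof (rule ccontr)
  assume "\<not> g x \<le> c"
  define U where "U = {a<..<b} \<inter> g -` {c<..}"
  have "open U"
    unfolding U_def using assms(1) by (intro continuous_open_preimage) auto
  moreover have "x \<in> U" using assms(3) \<open>\<not> g x \<le> c\<close> by (simp add: U_def)
  ultimately obtain e where "e > 0" "ball x e \<subseteq> U" by (auto simp: open_contains_ball)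
  obtain q where "x < of_rat q" "of_rat q < x + e"
    using of_rat_dense[of x "x + e"] \<open>e > 0\<close> by auto
  then have "of_rat q \<in> ball x e" by (simp add: dist_real_def)
  then have "of_rat q \<in> U" using \<open>ball x e \<subseteq> U\<close> by blast
  then show False using assms(2)[of q] by (simp add: U_def)
qed

text \<open>The set of points where the radial limit exists is Borel, because by continuity the Cauchy
  criterion need only be tested on rational radii.\<close>

lemma borel_measurable_radial_limit:
  assumes F: "F holomorphic_on ball 0 1"
  shows "radial_limit F \<in> borel_measurable circle_measure"
proof -
  define f where "f q z = (if 0 \<le> q \<and> q < 1 then F (of_real q * z) else 0)" for q :: real and z
  have f_meas [measurable]: "f q \<in> borel_measurable circle_measure" for q
  proof (cases "0 \<le> q \<and> q < 1")
    case True
    then have "f q = (\<lambda>z. F (of_real q * z))" by (simp add: f_def fun_eq_iff)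
    then show ?thesis using dilate_L2(1)[OF F, of q] True by simp
  next
    case False
    then have "f q = (\<lambda>_. 0)" by (auto simp: f_def fun_eq_iff)
    then show ?thesis by simp
  qed
  define E where "E z \<longleftrightarrow> (\<forall>k::nat. \<exists>m::nat. \<forall>p q :: rat.
      of_rat p \<in> {1 - 1 / real (m + 2)<..<1} \<longrightarrow> of_rat q \<in> {1 - 1 / real (m + 2)<..<1}
      \<longrightarrow> dist (f (of_rat p) z) (f (of_rat q) z) \<le> 1 / real (k + 1))" for z
  have E_meas [measurable]: "Measurable.pred circle_measure E"
    unfolding E_def by measurable
  have E_iff: "E z \<longleftrightarrow> (\<exists>l. ((\<lambda>r. F (of_real r * z)) \<longlongrightarrow> l) (at_left 1))" if z: "cmod z = 1" for z
  proof
    assume "\<exists>l. ((\<lambda>r. F (of_real r * z)) \<longlongrightarrow> l) (at_left 1)"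
    then obtain l where l: "((\<lambda>r. F (of_real r * z)) \<longlongrightarrow> l) (at_left 1)" ..
    show "E z"
      unfolding E_def
    proof
      fix k :: nat
      have "\<forall>\<^sub>F r in at_left 1. dist (F (of_real r * z)) l < 1 / real (k + 1) / 2"
        by (rule tendstoD[OF l]) simp
      then obtain b where b: "b < 1" "\<And>r. \<lbrakk>b < r; r < 1\<rbrakk> \<Longrightarrow> dist (F (of_real r * z)) l < 1 / real (k + 1) / 2"
        unfolding eventually_at_left_field by blast
      have "\<forall>\<^sub>F m in sequentially. b < radius_seq m"
        using radius_seq_lim b(1) by (rule order_tendstoD)
      then obtain m where m: "b < radius_seq m" by (auto simp: eventually_sequentially)
      have "dist (f p z) (f q z) \<le> 1 / real (k + 1)" if "p \<in> {radius_seq m<..<1}" "q \<in> {radius_seq m<..<1}" for p q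
      proof -
        have "0 \<le> p" "0 \<le> q" using that radius_seq(1)[of m] by auto
        then have "dist (f p z) l < 1 / real (k + 1) / 2" "dist (f q z) l < 1 / real (k + 1) / 2"
          using that b(2)[of p] b(2)[of q] m by (auto simp: f_def)
        then show ?thesis
          using dist_triangle2[of "f p z" "f q z" l] by linarith
      qed
      then show "\<exists>m::nat. \<forall>p q :: rat.
      of_rat p \<in> {1 - 1 / real (m + 2)<..<1} \<longrightarrow> of_rat q \<in> {1 - 1 / real (m + 2)<..<1}
      \<longrightarrow> dist (f (of_rat p) z) (f (of_rat q) z) \<le> 1 / real (k + 1)"
        unfolding radius_seq_def[symmetric] by blast
    qed
  next
    assume E: "E z"
    have close: "\<exists>m. \<forall>r\<in>{radius_seq m<..<1}. \<forall>s\<in>{radius_seq m<..<1}. dist (f r z) (f s z) \<le> 1 / real (k + 1)" for k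
    proof -
      obtain m where m: "\<And>p q :: rat. \<lbrakk>of_rat p \<in> {radius_seq m<..<1}; of_rat q \<in> {radius_seq m<..<1}\<rbrakk>
          \<Longrightarrow> dist (f (of_rat p) z) (f (of_rat q) z) \<le> 1 / real (k + 1)"
        using E unfolding E_def radius_seq_def[symmetric] by blast
      have cont: "continuous_on {radius_seq m<..<1} (\<lambda>r. f r z)"
      proof -
        have "continuous_on {radius_seq m<..<1} (\<lambda>r. F (of_real r * z))"
          using radius_seq(1)[of m] z
          by (intro continuous_on_compose2[OF holomorphic_on_imp_continuous_on[OF F]] continuous_intros)
             (auto simp: norm_mult)
        then show ?thesis
          by (rule continuous_on_eq) (use radius_seq(1)[of m] in \<open>auto simp: f_def\<close>)
      qed
      have 1: "dist (f r z) (f (of_rat q) z) \<le> 1 / real (k + 1)"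
        if "r \<in> {radius_seq m<..<1}" "of_rat q \<in> {radius_seq m<..<1}" for r q
        by (rule le_on_interval_if_rational[where g = "\<lambda>r. dist (f r z) (f (of_rat q) z)", OF _ _ that(1)])
           (intro continuous_intros cont m that(2); assumption)+
      have "dist (f r z) (f s z) \<le> 1 / real (k + 1)" if "r \<in> {radius_seq m<..<1}" "s \<in> {radius_seq m<..<1}" for r s
        by (rule le_on_interval_if_rational[where g = "\<lambda>s. dist (f r z) (f s z)", OF _ _ that(2)])
           (intro continuous_intros cont 1 that(1); assumption)+
      then show ?thesis by blast
    qed
    have ev_radius: "\<forall>\<^sub>F n in sequentially. radius_seq n \<in> {radius_seq m<..<1}" for m
      using order_tendstoD(1)[OF radius_seq_lim radius_seq(2)[of m]] by eventually_elim (use radius_seq in simp)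
    have "Cauchy (\<lambda>n. f (radius_seq n) z)"
    proof (rule metric_CauchyI)
      fix e :: real assume "e > 0"
      then obtain k where k: "1 / real (k + 1) < e" using nat_approx_posE by (metis Suc_eq_plus1)
      obtain m where m: "\<forall>r\<in>{radius_seq m<..<1}. \<forall>s\<in>{radius_seq m<..<1}. dist (f r z) (f s z) \<le> 1 / real (k + 1)"
        using close by blast
      obtain M where "\<And>n. n \<ge> M \<Longrightarrow> radius_seq n \<in> {radius_seq m<..<1}"
        using ev_radius[of m] unfolding eventually_sequentially by blast
      then show "\<exists>M. \<forall>i\<ge>M. \<forall>j\<ge>M. dist (f (radius_seq i) z) (f (radius_seq j) z) < e"
        using m k by (meson le_less_trans)
    qed
    then obtain l where l: "(\<lambda>n. f (radius_seq n) z) \<longlonglongrightarrow> l"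
      using Cauchy_convergent convergent_def by blast
    have "((\<lambda>r. F (of_real r * z)) \<longlongrightarrow> l) (at_left 1)"
    proof (rule tendstoI)
      fix e :: real assume "e > 0"
      then obtain k where k: "1 / real (k + 1) < e" using nat_approx_posE by (metis Suc_eq_plus1)
      obtain m where m: "\<forall>r\<in>{radius_seq m<..<1}. \<forall>s\<in>{radius_seq m<..<1}. dist (f r z) (f s z) \<le> 1 / real (k + 1)"
        using close by blast
      have le: "dist (f r z) l \<le> 1 / real (k + 1)" if "r \<in> {radius_seq m<..<1}" for r
      proof (rule tendsto_upperbound)
        show "(\<lambda>n. dist (f r z) (f (radius_seq n) z)) \<longlonglongrightarrow> dist (f r z) l"
          by (intro tendsto_intros l)
        show "\<forall>\<^sub>F n in sequentially. dist (f r z) (f (radius_seq n) z) \<le> 1 / real (k + 1)"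
          using ev_radius[of m] by eventually_elim (use m that in blast)
      qed simp
      have "\<forall>\<^sub>F r in at_left 1. r \<in> {radius_seq m<..<1}"
        by (rule eventually_at_left_real[OF radius_seq(2)])
      then show "\<forall>\<^sub>F r in at_left 1. dist (F (of_real r * z)) l < e"
      proof eventually_elim
        case (elim r)
        have "f r z = F (of_real r * z)" using elim radius_seq(1)[of m] by (simp add: f_def)
        then show ?case using le[OF elim] k by simp
      qed
    qed
    then show "\<exists>l. ((\<lambda>r. F (of_real r * z)) \<longlongrightarrow> l) (at_left 1)" ..
  qed
  \<comment> \<open>where no limit exists, \<^const>\<open>Topological_Spaces.Lim\<close> returns one fixed default value\<close>
  have eq: "radial_limit F z = (if E z then lim (\<lambda>n. f (radius_seq n) z) else (THE l. False))"
    if z: "cmod z = 1" for z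
  proof (cases "E z")
    case True
    then obtain l where l: "((\<lambda>r. F (of_real r * z)) \<longlongrightarrow> l) (at_left 1)"
      using E_iff[OF z] by blast
    have "(\<lambda>n. F (of_real (radius_seq n) * z)) \<longlonglongrightarrow> l"
      by (rule filterlim_compose[OF l radius_seq_left])
    then have "(\<lambda>n. f (radius_seq n) z) \<longlonglongrightarrow> l" using radius_seq by (simp add: f_def)
    then have "lim (\<lambda>n. f (radius_seq n) z) = l" by (rule limI)
    moreover have "radial_limit F z = l"
      unfolding radial_limit_def by (rule tendsto_Lim[OF _ l]) simp
    ultimately show ?thesis using True by simp
  next
    case False
    then have "(\<lambda>l. ((\<lambda>r. F (of_real r * z)) \<longlongrightarrow> l) (at_left 1)) = (\<lambda>l. False)"
      using E_iff[OF z] by blast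
    then show ?thesis using False by (simp add: radial_limit_def Topological_Spaces.Lim_def)
  qed
  have "(\<lambda>z. if E z then lim (\<lambda>n. f (radius_seq n) z) else (THE l. False)) \<in> borel_measurable circle_measure"
    by (intro measurable_If borel_measurable_lim_metric f_meas measurable_const E_meas[unfolded pred_def])
       (use E_meas[unfolded pred_def] in simp_all)
  then show ?thesis
    by (subst measurable_cong[OF eq]) auto
qed

lemma inner_boundary:
  assumes "inner_function \<theta>"
  shows "ess_bounded (radial_limit \<theta>)"
    and "AE z in circle_measure. cmod (radial_limit \<theta> z) = 1"
    and "AE z in circle_measure. ((\<lambda>r. \<theta> (of_real r * z)) \<longlongrightarrow> radial_limit \<theta> z) (at_left 1)"
proof -
  have ae: "AE z in circle_measure. \<exists>u. cmod u = 1 \<and> ((\<lambda>r. \<theta> (of_real r * z)) \<longlongrightarrow> u) (at_left (1::real))"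
    and hol: "\<theta> holomorphic_on ball 0 1"
    using assms by (auto simp: inner_function_def)
  have "AE z in circle_measure. cmod (radial_limit \<theta> z) = 1 \<and>
      ((\<lambda>r. \<theta> (of_real r * z)) \<longlongrightarrow> radial_limit \<theta> z) (at_left 1)"
    using ae
  proof eventually_elim
    case (elim z)
    then obtain u where u: "cmod u = 1" "((\<lambda>r. \<theta> (of_real r * z)) \<longlongrightarrow> u) (at_left (1::real))"
      by blast
    then have "radial_limit \<theta> z = u"
      unfolding radial_limit_def by (intro tendsto_Lim) auto
    then show ?case using u by simp
  qed
  then show 1: "AE z in circle_measure. cmod (radial_limit \<theta> z) = 1"
    and "AE z in circle_measure. ((\<lambda>r. \<theta> (of_real r * z)) \<longlongrightarrow> radial_limit \<theta> z) (at_left 1)"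
    by (auto elim: eventually_mono)
  show "ess_bounded (radial_limit \<theta>)"
    by (rule ess_bounded_unimodular[OF borel_measurable_radial_limit[OF hol] 1])
qed

text \<open>The dilates of \<open>\<theta>\<close> are bounded and converge almost everywhere, hence in the mean.\<close>

lemma inner_analytic:
  assumes "inner_function \<theta>"
  shows "abs_L2 (radial_limit \<theta>) \<in> analytic"
    and "cinner (abs_L2 (radial_limit \<theta>)) one_L2 = \<theta> 0"
proof -
  let ?R = "radial_limit \<theta>"
  have hol: "\<theta> holomorphic_on ball 0 1" and bdd: "bounded (\<theta> ` ball 0 1)"
    using assms by (auto simp: inner_function_def)
  obtain C where C: "\<And>w. cmod w < 1 \<Longrightarrow> cmod (\<theta> w) \<le> C"
    using bdd unfolding bounded_iff by (metis dist_0_norm imageI mem_ball)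
  note R = inner_boundary[OF assms]
  have R_meas: "?R \<in> borel_measurable circle_measure" using R(1) by (simp add: ess_bounded_def)
  let ?f = "\<lambda>n z. \<theta> (of_real (radius_seq n) * z)"
  have f_meas: "?f n \<in> borel_measurable circle_measure" for n
    by (rule dilate_L2(1)[OF hol radius_seq])
  have "(\<lambda>n. \<integral>z. (cmod (?f n z - ?R z))\<^sup>2 \<partial>circle_measure) \<longlonglongrightarrow> (\<integral>z. 0 \<partial>circle_measure)"
  proof (rule integral_dominated_convergence[where w = "\<lambda>_. (C + 1)\<^sup>2"])
    show "AE z in circle_measure. (\<lambda>n. (cmod (?f n z - ?R z))\<^sup>2) \<longlonglongrightarrow> 0"
      using R(3)
    proof eventually_elim
      case (elim z)
      have "(\<lambda>n. (cmod (?f n z - ?R z))\<^sup>2) \<longlonglongrightarrow> (cmod (?R z - ?R z))\<^sup>2"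
        by (intro tendsto_intros filterlim_compose[OF elim radius_seq_left])
      then show ?case by simp
    qed
    show "AE z in circle_measure. norm ((cmod (?f n z - ?R z))\<^sup>2) \<le> (C + 1)\<^sup>2" for n
      using R(2) AE_circle_norm
    proof eventually_elim
      case (elim z)
      have "cmod (of_real (radius_seq n) * z) < 1" using elim radius_seq[of n] by (simp add: norm_mult)
      then have "cmod (?f n z - ?R z) \<le> C + 1"
        using norm_triangle_ineq4[of "?f n z" "?R z"] C elim by fastforce
      then show ?case by (simp add: power_mono)
    qed
  qed (use f_meas R_meas in simp_all)
  moreover have "(\<integral>z. (cmod (?f n z - ?R z))\<^sup>2 \<partial>circle_measure) = (norm (abs_L2 (?f n) - abs_L2 ?R))\<^sup>2" for n
    using dilate_L2(2)[OF hol radius_seq] ess_bounded_sq_integrable[OF R(1)]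
    by (simp add: minus_abs_L2 norm_abs_L2 diff_sq_integrable)
  ultimately have "(\<lambda>n. (norm (abs_L2 (?f n) - abs_L2 ?R))\<^sup>2) \<longlonglongrightarrow> 0" by simp
  then have "(\<lambda>n. norm (abs_L2 (?f n) - abs_L2 ?R)) \<longlonglongrightarrow> 0" by simp
  then have lim: "(\<lambda>n. abs_L2 (?f n)) \<longlonglongrightarrow> abs_L2 ?R"
    by (rule LIM_zero_cancel[OF tendsto_norm_zero_cancel])
  show "abs_L2 ?R \<in> analytic"
    by (rule Lim_in_closed_set[OF closed_analytic _ _ lim])
       (simp_all add: dilate_L2(3)[OF hol radius_seq])
  have "(\<lambda>n. \<theta> 0) \<longlonglongrightarrow> cinner (abs_L2 ?R) one_L2"
    using tendsto_cinner_left[OF lim, of one_L2] by (simp add: dilate_L2(4)[OF hol radius_seq])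
  then show "cinner (abs_L2 ?R) one_L2 = \<theta> 0"
    by (simp add: LIMSEQ_const_iff)
qed

section \<open>A bilateral shift with one modified weight\<close>

lemma mult_L2_eq_0:
  assumes "ess_bounded \<phi>" "AE z in circle_measure. \<phi> z \<noteq> 0" "mult_L2 \<phi> f = 0"
  shows "f = 0"
proof (cases f)
  case (1 g)
  have m: "(\<lambda>z. \<phi> z * g z) \<in> sq_integrable" using assms(1) 1(2) by (rule mult_sq_integrable)
  have eq: "abs_L2 (\<lambda>z. \<phi> z * g z) = abs_L2 (\<lambda>_. 0)"
    using assms(3) 1 by (simp add: mult_L2_abs assms(1) zero_L2_circle.abs_eq)
  have "AE z in circle_measure. \<phi> z * g z = 0"
    using AE_rep_abs_L2[OF m] AE_rep_abs_L2[OF zero_sq_integrable] unfolding eq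
    by eventually_elim simp
  then have "AE z in circle_measure. g z = 0"
    using assms(2) by eventually_elim simp
  then show ?thesis
    using abs_L2_eqI[OF 1(2) zero_sq_integrable] 1 by (simp add: zero_L2_circle.abs_eq)
qed

lemma norm_orthonormal_seq: "orthonormal_seq v \<Longrightarrow> norm (v n) = 1"
  using norm_orthonormal_sum[of v "{n}" "\<lambda>_. 1"] by (simp add: scaleC_algebra power2_eq_1_iff) (smt (verit) norm_ge_zero)

text \<open>The functions \<open>u ^ n e\<close>, \<open>n\<close> an integer, form an orthonormal system.  The operator \<open>T\<close> below is
  multiplication by \<open>u\<close>, except that \<open>u ^ (-1) e\<close> is sent to \<open>a e\<close> instead of \<open>e\<close>.\<close>

locale weighted_shift =
  fixes u :: "complex \<Rightarrow> complex" and e :: L2_circle and a :: complex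
  assumes u_bounded: "ess_bounded u"
    and u_unimodular: "AE z in circle_measure. cmod (u z) = 1"
    and u_no_atom: "\<And>w. AE z in circle_measure. u z \<noteq> w"
    and e_unit: "cinner e e = 1"
    and e_wandering: "\<And>n. n > 0 \<Longrightarrow> cinner (mult_L2 (\<lambda>z. u z ^ n) e) e = 0"
begin

definition W :: "L2_circle \<Rightarrow> L2_circle" where "W = mult_L2 u"
definition W' :: "L2_circle \<Rightarrow> L2_circle" where "W' = mult_L2 (\<lambda>z. cnj (u z))"
definition fwd :: "nat \<Rightarrow> L2_circle" where "fwd n = mult_L2 (\<lambda>z. u z ^ n) e"
definition bwd :: "nat \<Rightarrow> L2_circle" where "bwd n = mult_L2 (\<lambda>z. cnj (u z) ^ n) e"

definition T :: "L2_circle \<Rightarrow> L2_circle" where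
  "T f = W f + ((a - 1) * cinner (W f) e) *\<^sub>C e"

lemma W_linear: "W (f + g) = W f + W g" "W (f - g) = W f - W g" "W (c *\<^sub>C f) = c *\<^sub>C W f"
  by (simp_all add: W_def u_bounded mult_L2_add mult_L2_diff mult_L2_scaleC)

lemma W_cancel: "W (W' f) = f" "W' (W f) = f"
  unfolding W_def W'_def by (intro mult_L2_unimodular_cancel u_bounded u_unimodular)+

lemma cinner_W: "cinner (W f) g = cinner f (W' g)"
  by (simp add: W_def W'_def cinner_mult_L2 u_bounded)

lemma T_linear: "T (f + g) = T f + T g" "T (c *\<^sub>C f) = c *\<^sub>C T f"
  by (simp only: T_def W_linear cinner_add_left distrib_left scaleC_algebra(2) add_ac)
    (simp only: T_def W_linear cinner_scaleC_left scaleC_algebra(1,3) mult.left_commute)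

lemma T_diff: "T (f - g) = T f - T g"
  using T_linear(1)[of "f - g" g] by simp

lemma T_0: "T 0 = 0"
  using T_linear(2)[of 0 0] by simp

lemma u_power_bounded: "ess_bounded (\<lambda>z. u z ^ n)" "ess_bounded (\<lambda>z. cnj (u z) ^ n)"
  by (induction n) (simp_all add: ess_bounded_mult u_bounded ess_bounded_cnj)

lemma fwd_0: "fwd 0 = e" and bwd_0: "bwd 0 = e"
  by (simp_all add: fwd_def bwd_def mult_L2_const scaleC_algebra)

lemma W_fwd: "W (fwd n) = fwd (Suc n)" and W'_bwd: "W' (bwd n) = bwd (Suc n)"
  by (simp_all add: W_def W'_def fwd_def bwd_def mult_L2_mult u_power_bounded u_bounded ess_bounded_cnj)

lemma W'_fwd: "W' (fwd (Suc n)) = fwd n"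
  by (simp add: W_fwd[symmetric] W_cancel)

lemma orthonormal_fwd: "orthonormal_seq fwd"
  using orthonormal_powers[OF u_bounded u_unimodular e_unit e_wandering] by (simp add: fwd_def[abs_def])

lemma orthonormal_bwd: "orthonormal_seq bwd"
proof -
  have "cinner (mult_L2 (\<lambda>z. cnj (u z) ^ n) e) e = 0" if "n > 0" for n
  proof -
    have "cinner (mult_L2 (\<lambda>z. cnj (u z) ^ n) e) e = cinner e (mult_L2 (\<lambda>z. u z ^ n) e)"
      by (simp add: cinner_mult_L2 u_power_bounded)
    then show ?thesis using e_wandering[OF that] cinner_eq_0_commute by auto
  qed
  from orthonormal_powers[OF ess_bounded_cnj[OF u_bounded] _ e_unit this] u_unimodular
  show ?thesis by (simp add: bwd_def[abs_def])
qed

lemma cinner_e_fwd: "cinner e (fwd (Suc n)) = 0"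
  using orthonormal_seqD[OF orthonormal_fwd, of 0 "Suc n"] by (simp add: fwd_0)

lemma cinner_e_bwd: "cinner e (bwd (Suc n)) = 0"
  using orthonormal_seqD[OF orthonormal_bwd, of 0 "Suc n"] by (simp add: bwd_0)

lemma cinner_W_e: "cinner (W f) e = cinner f (bwd (Suc 0))"
  using W'_bwd[of 0] by (simp add: cinner_W bwd_0)

lemma cinner_fwd_bwd: "n > 0 \<Longrightarrow> cinner (fwd m) (bwd n) = 0"
proof -
  assume "n > 0"
  have "cinner (fwd m) (bwd n) = cinner (fwd (m + n)) e"
    by (induction n arbitrary: m) (simp_all add: bwd_0 W'_bwd[symmetric] cinner_W[symmetric] W_fwd)
  also have "\<dots> = 0"
    using \<open>n > 0\<close> e_wandering[of "m + n"] by (simp add: fwd_def)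
  finally show ?thesis .
qed

lemma T_fwd: "T (fwd n) = fwd (Suc n)"
proof -
  have "cinner (W (fwd n)) e = 0"
    unfolding cinner_W_e by (rule cinner_fwd_bwd) simp
  then show ?thesis by (simp only: T_def W_fwd mult_zero_right scaleC_algebra(5) add_0_right)
qed

lemma cinner_T_fwd: "cinner (T f) (fwd (Suc n)) = cinner f (fwd n)"
  by (simp only: T_def cinner_add_left cinner_scaleC_left cinner_e_fwd cinner_W W'_fwd mult_zero_right add_0_right)

lemma cinner_T_bwd: "cinner (T f) (bwd (Suc n)) = cinner f (bwd (Suc (Suc n)))"
  by (simp only: T_def cinner_add_left cinner_scaleC_left cinner_e_bwd cinner_W W'_bwd mult_zero_right add_0_right)

lemma cinner_T_e: "cinner (T f) e = a * cinner f (bwd (Suc 0))"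
  by (simp only: T_def cinner_add_left cinner_scaleC_left e_unit cinner_W_e left_diff_distrib mult_1 mult_1_right
      diff_add_cancel add.commute[of "cinner f (bwd (Suc 0))"])

lemma fwd_coeffs_vanish:
  assumes "cmod \<mu> = 1" "\<And>n. n \<ge> k \<Longrightarrow> cinner f (fwd n) = \<mu> * cinner f (fwd (Suc n))" "n \<ge> k"
  shows "cinner f (fwd n) = 0"
proof -
  have "orthonormal_seq (\<lambda>n. fwd (n + k))"
    using orthonormal_fwd by (simp add: orthonormal_seq_def)
  moreover have "cmod (cinner f (fwd (Suc m + k))) = cmod (cinner f (fwd (m + k)))" for m
    using assms(1) assms(2)[of "m + k"] by (simp add: norm_mult)
  ultimately have "cinner f (fwd (m + k)) = 0" for m
    by (rule orthonormal_coeff_const_modulus)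
  from this[of "n - k"] show ?thesis using assms(3) by simp
qed

lemma bwd_coeffs_vanish:
  assumes "cmod \<mu> = 1" "\<And>n. cinner f (bwd (Suc (Suc n))) = \<mu> * cinner f (bwd (Suc n))"
  shows "cinner f (bwd (Suc n)) = 0"
proof -
  have "orthonormal_seq (\<lambda>n. bwd (Suc n))"
    using orthonormal_bwd by (simp add: orthonormal_seq_def)
  moreover have "cmod (cinner f (bwd (Suc (Suc m)))) = cmod (cinner f (bwd (Suc m)))" for m
    using assms by (simp add: norm_mult)
  ultimately show ?thesis
    by (rule orthonormal_coeff_const_modulus)
qed

text \<open>The backward coefficients of an eigenvector have constant modulus, so they vanish and the
  modified weight is never felt; but multiplication by \<open>u\<close> has no eigenvalue, as \<open>u\<close> takes no
  value on a set of positive measure.\<close>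

lemma no_unimodular_eigenvalue:
  assumes mu: "cmod \<mu> = 1" and eq: "T f = \<mu> *\<^sub>C f"
  shows "f = 0"
proof -
  have "cinner f (bwd (Suc (Suc n))) = \<mu> * cinner f (bwd (Suc n))" for n
    using cinner_T_bwd[of f n] by (simp add: eq cinner_scaleC_left)
  from bwd_coeffs_vanish[OF mu this, of 0] have "cinner (W f) e = 0"
    by (simp add: cinner_W_e)
  then have "W f - \<mu> *\<^sub>C f = 0"
    using eq by (simp add: T_def scaleC_algebra)
  then have "mult_L2 (\<lambda>z. u z - \<mu>) f = 0"
    by (simp add: W_def mult_L2_diff_symbol u_bounded mult_L2_const)
  then show "f = 0"
    by (rule mult_L2_eq_0[rotated 2]) (use u_no_atom[of \<mu>] in \<open>simp_all add: ess_bounded_diff u_bounded\<close>)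
qed

text \<open>The range contains the differences of the vectors \<open>w k = (cnj \<mu>) ^ k u ^ k e\<close> with \<open>k \<ge> 1\<close>.  Averages of
  \<open>M\<close> of them have norm \<open>1 / sqrt M\<close>, so \<open>w 1\<close> is a limit of elements of the range.  If
  \<open>T f - \<mu> f = u e\<close>, comparing coefficients shows that those of \<open>f\<close> have constant modulus along
  \<open>u ^ n e\<close> for \<open>n \<ge> 1\<close> and for \<open>n \<le> -1\<close>; so these vanish, and the two remaining equations
  contradict each other.\<close>

lemma range_not_closed:
  assumes mu: "cmod \<mu> = 1"
  shows "\<not> closed (range (\<lambda>f. T f - \<mu> *\<^sub>C f))"
proof
  define R where "R = range (\<lambda>f. T f - \<mu> *\<^sub>C f)"
  assume "closed (range (\<lambda>f. T f - \<mu> *\<^sub>C f))"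
  then have closed: "closed R" by (simp add: R_def)
  have R_add: "x + y \<in> R" if xy: "x \<in> R" "y \<in> R" for x y
  proof -
    obtain f g where "x = T f - \<mu> *\<^sub>C f" "y = T g - \<mu> *\<^sub>C g" using xy unfolding R_def by blast
    then have "x + y = T (f + g) - \<mu> *\<^sub>C (f + g)" by (simp add: T_linear scaleC_algebra)
    then show ?thesis unfolding R_def by blast
  qed
  have R_scale: "c *\<^sub>C x \<in> R" if x: "x \<in> R" for c x
  proof -
    obtain f where "x = T f - \<mu> *\<^sub>C f" using x unfolding R_def by blast
    then have "c *\<^sub>C x = T (c *\<^sub>C f) - \<mu> *\<^sub>C (c *\<^sub>C f)"
      by (simp add: T_linear scaleC_diff_right scaleC_algebra mult.commute)
    then show ?thesis unfolding R_def by blast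
  qed
  have R_0: "0 \<in> R" unfolding R_def by (rule image_eqI[of _ _ 0]) (simp_all add: T_0)
  have mu': "cnj \<mu> * \<mu> = 1" using mu complex_norm_square[of \<mu>] by (simp add: mult.commute)
  define w where "w k = cnj \<mu> ^ k *\<^sub>C fwd k" for k
  have step: "w (Suc k) - w k \<in> R" for k
  proof -
    have "w (Suc k) - w k = cnj \<mu> ^ Suc k *\<^sub>C (T (fwd k) - \<mu> *\<^sub>C fwd k)"
      using mu' by (simp add: w_def T_fwd scaleC_diff_right scaleC_algebra mult_ac)
    then show ?thesis by (simp only:) (rule R_scale, simp add: R_def)
  qed
  have diff: "w (Suc k) - w (Suc 0) \<in> R" for k
  proof (induction k)
    case (Suc k)
    have "w (Suc (Suc k)) - w (Suc 0) = (w (Suc (Suc k)) - w (Suc k)) + (w (Suc k) - w (Suc 0))" by simp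
    then show ?case by (simp only:) (rule R_add[OF step Suc])
  qed (simp add: R_0)
  \<comment> \<open>averages that tend to zero\<close>
  define p where "p M = of_real (1 / real (Suc M)) *\<^sub>C (\<Sum>k<Suc M. w (Suc k))" for M
  have p_R: "p M - w (Suc 0) \<in> R" for M
  proof -
    have "(\<Sum>k<n. w (Suc k) - w (Suc 0)) \<in> R" for n
      by (induction n) (simp_all add: R_0 R_add diff)
    from R_scale[OF this[of "Suc M"], of "of_real (1 / real (Suc M))"]
    have "(1 / real (Suc M)) *\<^sub>R (\<Sum>k<Suc M. w (Suc k) - w (Suc 0)) \<in> R"
      by (simp only: scaleC_of_real)
    moreover have "(\<Sum>k<Suc M. w (Suc k) - w (Suc 0)) = (\<Sum>k<Suc M. w (Suc k)) - real (Suc M) *\<^sub>R w (Suc 0)"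
      by (simp only: sum_subtractf sum_constant_scaleR card_lessThan)
    ultimately show ?thesis
      by (simp add: p_def scaleR_diff_right scaleC_of_real del: of_real_divide sum.lessThan_Suc)
  qed
  have p_norm: "norm (p M) = sqrt (inverse (real (Suc M)))" for M
  proof -
    have "orthonormal_seq (\<lambda>k. fwd (Suc k))"
      using orthonormal_fwd by (simp add: orthonormal_seq_def)
    from norm_orthonormal_sum[OF this, of "{..<Suc M}" "\<lambda>k. cnj \<mu> ^ Suc k"]
    have "(norm (\<Sum>k<Suc M. w (Suc k)))\<^sup>2 = real (Suc M)"
      by (simp add: w_def mu norm_mult norm_power del: sum.lessThan_Suc)
    then have "norm (\<Sum>k<Suc M. w (Suc k)) = sqrt (real (Suc M))"
      by (metis norm_ge_zero real_sqrt_unique)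
    then have "norm (p M) = sqrt (real (Suc M)) / real (Suc M)"
      by (simp add: p_def norm_divide del: sum.lessThan_Suc of_nat_Suc)
    then show ?thesis
      by (simp only: sqrt_divide_self_eq[OF of_nat_0_le_iff] real_sqrt_inverse)
  qed
  have "(\<lambda>M. norm (p M)) \<longlonglongrightarrow> 0"
    unfolding p_norm using tendsto_real_sqrt[OF LIMSEQ_inverse_real_of_nat] by simp
  then have "p \<longlonglongrightarrow> 0" by (rule tendsto_norm_zero_cancel)
  then have "(\<lambda>M. p M - w (Suc 0)) \<longlonglongrightarrow> 0 - w (Suc 0)" by (intro tendsto_intros)
  then have "0 - w (Suc 0) \<in> R"
    by (rule Lim_in_closed_set[OF closed, rotated 2]) (use p_R in simp_all)
  then have "(- \<mu>) *\<^sub>C (0 - w (Suc 0)) \<in> R" by (rule R_scale)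
  also have "(- \<mu>) *\<^sub>C (0 - w (Suc 0)) = fwd (Suc 0)"
    using mu' by (simp add: w_def scaleC_diff_right scaleC_algebra mult.commute)
  finally have "fwd (Suc 0) \<in> range (\<lambda>f. T f - \<mu> *\<^sub>C f)" unfolding R_def .
  then obtain f where f: "fwd (Suc 0) = T f - \<mu> *\<^sub>C f" by (rule rangeE)
  have coeff: "cinner (T f) g - \<mu> * cinner f g = cinner (fwd (Suc 0)) g" for g
    by (simp only: f cinner_diff_left cinner_scaleC_left)
  have fwd_fwd: "cinner (fwd (Suc 0)) (fwd n) = of_bool (n = Suc 0)" for n
    using orthonormal_seqD[OF orthonormal_fwd, of "Suc 0" n] by auto
  have "cinner f (fwd (Suc 0)) = 0"
  proof (rule fwd_coeffs_vanish[OF mu, of 1])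
    fix n :: nat assume "1 \<le> n"
    then show "cinner f (fwd n) = \<mu> * cinner f (fwd (Suc n))"
      using coeff[of "fwd (Suc n)"] fwd_fwd[of "Suc n"] by (simp add: cinner_T_fwd)
  qed simp
  then have f0: "cinner f e = 1"
    using coeff[of "fwd (Suc 0)"] fwd_fwd[of "Suc 0"] by (simp add: cinner_T_fwd fwd_0)
  have "cinner f (bwd (Suc (Suc n))) = \<mu> * cinner f (bwd (Suc n))" for n
    using coeff[of "bwd (Suc n)"] by (simp add: cinner_T_bwd cinner_fwd_bwd)
  from bwd_coeffs_vanish[OF mu this, of 0] have "cinner f (bwd (Suc 0)) = 0" by simp
  then have "\<mu> = 0"
    using coeff[of e] f0 fwd_fwd[of 0] by (simp add: cinner_T_e fwd_0)
  then show False using mu by simp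
qed

subsection \<open>Off the unit circle\<close>

definition Res :: "complex \<Rightarrow> L2_circle \<Rightarrow> L2_circle" where
  "Res \<mu> = mult_L2 (\<lambda>z. 1 / (u z - \<mu>))"

lemma resolvent_symbol_bounded:
  assumes "cmod \<mu> \<noteq> 1" shows "ess_bounded (\<lambda>z. 1 / (u z - \<mu>))"
proof -
  have "AE z in circle_measure. cmod (1 / (u z - \<mu>)) \<le> 1 / \<bar>1 - cmod \<mu>\<bar>"
    using u_unimodular
  proof eventually_elim
    case (elim z)
    have "\<bar>1 - cmod \<mu>\<bar> \<le> cmod (u z - \<mu>)"
      using norm_triangle_ineq3[of "u z" \<mu>] elim by simp
    then show ?case using assms by (simp add: norm_divide divide_simps)
  qed
  moreover have "(\<lambda>z. 1 / (u z - \<mu>)) \<in> borel_measurable circle_measure"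
    using u_bounded by (auto simp: ess_bounded_def)
  ultimately show ?thesis by (auto simp: ess_bounded_def)
qed

lemma Res_inverse:
  assumes "cmod \<mu> \<noteq> 1"
  shows "W (Res \<mu> g) - \<mu> *\<^sub>C Res \<mu> g = g" "Res \<mu> (W g - \<mu> *\<^sub>C g) = g"
proof -
  note b = resolvent_symbol_bounded[OF assms]
  have b': "ess_bounded (\<lambda>z. u z - \<mu>)" by (intro ess_bounded_diff u_bounded ess_bounded_const)
  have W: "W g - \<mu> *\<^sub>C g = mult_L2 (\<lambda>z. u z - \<mu>) g" for g
    by (simp add: W_def mult_L2_diff_symbol u_bounded mult_L2_const)
  have id: "mult_L2 (\<lambda>_. 1) g = g" by (simp add: mult_L2_const scaleC_algebra)
  have ae: "AE z in circle_measure. (u z - \<mu>) * (1 / (u z - \<mu>)) = 1"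
    "AE z in circle_measure. 1 / (u z - \<mu>) * (u z - \<mu>) = 1"
    using u_no_atom[of \<mu>] by (eventually_elim, simp)+
  have "mult_L2 (\<lambda>z. (u z - \<mu>) * (1 / (u z - \<mu>))) g = mult_L2 (\<lambda>_. 1) g"
    by (rule mult_L2_cong[OF ess_bounded_mult[OF b' b] ess_bounded_const ae(1)])
  moreover have "mult_L2 (\<lambda>z. 1 / (u z - \<mu>) * (u z - \<mu>)) g = mult_L2 (\<lambda>_. 1) g"
    by (rule mult_L2_cong[OF ess_bounded_mult[OF b b'] ess_bounded_const ae(2)])
  ultimately show "W (Res \<mu> g) - \<mu> *\<^sub>C Res \<mu> g = g" "Res \<mu> (W g - \<mu> *\<^sub>C g) = g"
    unfolding W Res_def by (simp_all only: mult_L2_mult b b' id)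
qed

text \<open>The coefficients of \<open>h = Res \<mu> e\<close> satisfy the two-term recursion given by
  \<open>u h - \<mu> h = e\<close>.  Running it in the direction in which it would grow geometrically forces the
  starting coefficient to be zero.\<close>

lemma cinner_Res_e:
  assumes "cmod \<mu> \<noteq> 1"
  shows "cinner (Res \<mu> e) (bwd (Suc 0)) = (if cmod \<mu> < 1 then 1 else 0)"
proof -
  define h where "h = Res \<mu> e"
  have h: "cinner (W h) g - \<mu> * cinner h g = cinner e g" for g
    using Res_inverse(1)[OF assms, of e] by (metis h_def cinner_diff_left cinner_scaleC_left)
  have decay: "c = 0" if "\<And>n. cmod c \<le> r ^ n * norm h" "0 \<le> r" "r < 1" for c r
  proof -
    have "(\<lambda>n. r ^ n * norm h) \<longlonglongrightarrow> 0 * norm h"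
      using that by (intro tendsto_intros LIMSEQ_power_zero) auto
    then have "cmod c \<le> 0 * norm h"
      by (rule LIMSEQ_le_const) (use that in auto)
    then show ?thesis by simp
  qed
  show ?thesis
  proof (cases "cmod \<mu> < 1")
    case True
    have step: "cinner h (fwd n) = \<mu> * cinner h (fwd (Suc n))" for n
      using h[of "fwd (Suc n)"] by (simp add: cinner_W W'_fwd cinner_e_fwd)
    have "cinner h (fwd 0) = \<mu> ^ n * cinner h (fwd n)" for n
    proof (induction n)
      case (Suc n)
      then show ?case using step[of n] by (metis power_Suc2 mult.assoc)
    qed simp
    then have "cmod (cinner h (fwd 0)) = cmod \<mu> ^ n * cmod (cinner h (fwd n))" for n
      by (metis norm_mult norm_power)
    moreover have "cmod (cinner h (fwd n)) \<le> norm h" for n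
      using cinner_Cauchy_Schwarz[of h "fwd n"] by (simp add: norm_orthonormal_seq[OF orthonormal_fwd])
    ultimately have "cmod (cinner h (fwd 0)) \<le> cmod \<mu> ^ n * norm h" for n
      by (metis mult_left_mono norm_ge_zero zero_le_power)
    then have "cinner h (fwd 0) = 0" by (rule decay) (use True in auto)
    then show ?thesis using h[of e] True by (simp add: cinner_W_e e_unit fwd_0 h_def)
  next
    case False
    then have mu: "cmod \<mu> > 1" using assms by simp
    have "cinner h (bwd (Suc (Suc n))) = \<mu> * cinner h (bwd (Suc n))" for n
      using h[of "bwd (Suc n)"] by (simp add: cinner_W W'_bwd cinner_e_bwd)
    then have "cinner h (bwd (Suc n)) = \<mu> ^ n * cinner h (bwd (Suc 0))" for n
      by (induction n) (simp_all add: mult_ac)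
    then have "cmod (cinner h (bwd (Suc n))) = cmod \<mu> ^ n * cmod (cinner h (bwd (Suc 0)))" for n
      by (metis norm_mult norm_power)
    moreover have "cmod (cinner h (bwd n)) \<le> norm h" for n
      using cinner_Cauchy_Schwarz[of h "bwd n"] by (simp add: norm_orthonormal_seq[OF orthonormal_bwd])
    ultimately have "cmod \<mu> ^ n * cmod (cinner h (bwd (Suc 0))) \<le> norm h" for n
      by metis
    then have "cmod (cinner h (bwd (Suc 0))) \<le> (1 / cmod \<mu>) ^ n * norm h" for n
    proof -
      fix n
      assume "\<And>n. cmod \<mu> ^ n * cmod (cinner h (bwd (Suc 0))) \<le> norm h"
      moreover have "cmod \<mu> ^ n > 0" by (rule zero_less_power) (use mu in linarith)
      ultimately show "cmod (cinner h (bwd (Suc 0))) \<le> (1 / cmod \<mu>) ^ n * norm h"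
        by (simp add: power_divide field_simps)
    qed
    moreover have "0 \<le> 1 / cmod \<mu>" "1 / cmod \<mu> < 1"
      using mu by (simp, subst divide_less_eq_1_pos) linarith+
    ultimately have "cinner h (bwd (Suc 0)) = 0" by (rule decay)
    then show ?thesis using False by (simp add: h_def)
  qed
qed

lemma T_minus:
  "T f - \<mu> *\<^sub>C f = (W f - \<mu> *\<^sub>C f) + ((a - 1) * cinner f (bwd (Suc 0))) *\<^sub>C e"
  by (simp add: T_def cinner_W_e)

lemma Res_linear:
  assumes "cmod \<mu> \<noteq> 1"
  shows "Res \<mu> (f + g) = Res \<mu> f + Res \<mu> g" "Res \<mu> (f - g) = Res \<mu> f - Res \<mu> g"
    "Res \<mu> (c *\<^sub>C f) = c *\<^sub>C Res \<mu> f"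
  using resolvent_symbol_bounded[OF assms]
  by (simp_all add: Res_def mult_L2_add mult_L2_diff mult_L2_scaleC)

text \<open>\<open>T - \<mu>\<close> differs from the invertible \<open>W - \<mu>\<close> by an operator of rank one.  Solving for the single
  unknown coefficient \<open>cinner f (bwd 1)\<close> is possible as long as the scalar \<open>d\<close> is not zero, and
  \<open>d\<close> is \<open>a\<close> inside the disk and \<open>1\<close> outside.\<close>

lemma invertible_off_circle:
  assumes mu: "cmod \<mu> \<noteq> 1" and or: "a \<noteq> 0 \<or> cmod \<mu> > 1"
  shows "invertible_on UNIV (\<lambda>f. T f - \<mu> *\<^sub>C f)"
proof -
  define \<kappa> where "\<kappa> = cinner (Res \<mu> e) (bwd (Suc 0))"
  define d where "d = 1 + (a - 1) * \<kappa>"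
  have d: "d \<noteq> 0" using or mu by (auto simp: d_def \<kappa>_def cinner_Res_e)
  \<comment> \<open>the coefficient that the solution \<open>f\<close> of \<open>T f - \<mu> f = g\<close> must have along \<open>bwd 1\<close>\<close>
  define c where "c g = cinner (Res \<mu> g) (bwd (Suc 0)) / d" for g
  define S where "S g = Res \<mu> g - ((a - 1) * c g) *\<^sub>C Res \<mu> e" for g
  have c_linear: "c (f + g) = c f + c g" "c (k *\<^sub>C f) = k * c f" for f g k
    by (simp_all add: c_def Res_linear mu cinner_add_left cinner_scaleC_left add_divide_distrib)
  have S_c: "cinner (S g) (bwd (Suc 0)) = c g" for g
  proof -
    have "cinner (S g) (bwd (Suc 0)) = d * c g - (a - 1) * c g * \<kappa>"
      using d by (simp add: S_def cinner_diff_left cinner_scaleC_left c_def \<kappa>_def)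
    also have "\<dots> = c g" by (simp add: d_def algebra_simps)
    finally show ?thesis .
  qed
  have WS: "W (S g) - \<mu> *\<^sub>C S g = g - ((a - 1) * c g) *\<^sub>C e" for g
  proof -
    have "S g = Res \<mu> (g - ((a - 1) * c g) *\<^sub>C e)" by (simp add: S_def Res_linear mu)
    then show ?thesis by (simp add: Res_inverse(1)[OF mu])
  qed
  have TS: "T (S g) - \<mu> *\<^sub>C S g = g" for g
    unfolding T_minus WS S_c by simp
  have inj: "f = 0" if "T f - \<mu> *\<^sub>C f = 0" for f
  proof -
    define k where "k = cinner f (bwd (Suc 0))"
    have "W f - \<mu> *\<^sub>C f = - (((a - 1) * k) *\<^sub>C e)"
      using that unfolding T_minus k_def by (simp only: add_eq_0_iff2)
    then have "Res \<mu> (W f - \<mu> *\<^sub>C f) = Res \<mu> (- ((a - 1) * k) *\<^sub>C e)"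
      by simp
    then have f: "f = - ((a - 1) * k) *\<^sub>C Res \<mu> e"
      by (simp only: Res_inverse(2)[OF mu] Res_linear(3)[OF mu])
    have "k = - ((a - 1) * k) * \<kappa>"
      by (subst k_def, subst f) (simp only: cinner_scaleC_left \<kappa>_def)
    then have "d * k = 0" by (simp add: d_def algebra_simps)
    then have "k = 0" using d by simp
    then show "f = 0" using f by (simp add: scaleC_algebra)
  qed
  have S_linear: "S (f + g) = S f + S g" "S (k *\<^sub>C f) = k *\<^sub>C S f" for f g k
    unfolding S_def c_linear Res_linear[OF mu]
    by (simp_all only: scaleC_diff_right scaleC_algebra distrib_left mult_ac) simp_all
  have ST: "S (T f - \<mu> *\<^sub>C f) = f" for f
  proof -
    let ?g = "S (T f - \<mu> *\<^sub>C f)"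
    have "T (?g - f) - \<mu> *\<^sub>C (?g - f) = (T ?g - \<mu> *\<^sub>C ?g) - (T f - \<mu> *\<^sub>C f)"
      by (simp add: T_diff scaleC_diff_right)
    also have "\<dots> = 0" by (simp only: TS diff_self)
    finally have "?g - f = 0" by (rule inj)
    then show ?thesis by simp
  qed
  have bl: "bounded_linear (Res \<mu>)"
    unfolding Res_def by (rule bounded_linear_mult_L2[OF resolvent_symbol_bounded[OF mu]])
  then obtain K where K: "\<And>g. norm (Res \<mu> g) \<le> norm g * K" "K \<ge> 0"
    using bounded_linear.nonneg_bounded by blast
  have "norm (S g) \<le> (K + cmod (a - 1) * (K / cmod d) * norm (Res \<mu> e)) * norm g" for g
  proof -
    have "cmod (cinner (Res \<mu> g) (bwd (Suc 0))) \<le> norm g * K"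
      using cinner_Cauchy_Schwarz[of "Res \<mu> g" "bwd (Suc 0)"] K(1)[of g]
      by (simp add: norm_orthonormal_seq[OF orthonormal_bwd])
    then have c: "cmod (c g) \<le> norm g * K / cmod d"
      by (simp add: c_def norm_divide divide_right_mono)
    have "norm (S g) \<le> norm (Res \<mu> g) + cmod (a - 1) * cmod (c g) * norm (Res \<mu> e)"
      unfolding S_def using norm_triangle_ineq4[of "Res \<mu> g" "((a - 1) * c g) *\<^sub>C Res \<mu> e"]
      by (simp add: norm_mult)
    also have "\<dots> \<le> norm g * K + cmod (a - 1) * (norm g * K / cmod d) * norm (Res \<mu> e)"
      by (intro add_mono K mult_right_mono mult_left_mono c) auto
    finally show ?thesis by (simp add: algebra_simps)
  qed
  then have "bounded_op_on UNIV S"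
    unfolding bounded_op_on_def using S_linear by blast
  then show ?thesis
    unfolding invertible_on_def by (intro exI[of _ S]) (simp add: ST TS)
qed

text \<open>With weight zero the operator splits into a unilateral shift and a backward shift, whose
  spectral behaviour inside the disk is visible here: a one-dimensional kernel and a range of
  codimension one.\<close>

lemma zero_weight_inside:
  assumes a: "a = 0" and mu: "cmod \<mu> < 1"
  shows "T (Res \<mu> e) = \<mu> *\<^sub>C Res \<mu> e" "Res \<mu> e \<noteq> 0"
    and "fredholm_on UNIV (\<lambda>f. T f - \<mu> *\<^sub>C f)"
proof -
  have mu1: "cmod \<mu> \<noteq> 1" using mu by simp
  have \<kappa>: "cinner (Res \<mu> e) (bwd (Suc 0)) = 1" using cinner_Res_e[OF mu1] mu by simp
  have "T (Res \<mu> e) - \<mu> *\<^sub>C Res \<mu> e = 0"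
    unfolding T_minus Res_inverse(1)[OF mu1] \<kappa> by (simp add: a scaleC_minus1[simplified])
  then show "T (Res \<mu> e) = \<mu> *\<^sub>C Res \<mu> e" by simp
  show "Res \<mu> e \<noteq> 0" using \<kappa> by auto
  define v where "v = mult_L2 (\<lambda>z. cnj (1 / (u z - \<mu>))) (bwd (Suc 0))"
  have v: "cinner (Res \<mu> g) (bwd (Suc 0)) = cinner g v" for g
    unfolding Res_def v_def by (rule cinner_mult_L2[OF resolvent_symbol_bounded[OF mu1]])
  have range: "range (\<lambda>f. T f - \<mu> *\<^sub>C f) = orth {v}"
  proof (intro equalityI subsetI)
    fix g assume "g \<in> orth {v}"
    then have "cinner (Res \<mu> g) (bwd (Suc 0)) = 0" by (simp add: orth_def v)
    then have "T (Res \<mu> g) - \<mu> *\<^sub>C Res \<mu> g = g"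
      unfolding T_minus Res_inverse(1)[OF mu1] by (simp add: scaleC_algebra)
    from this[symmetric] show "g \<in> range (\<lambda>f. T f - \<mu> *\<^sub>C f)" by (rule image_eqI) simp
  next
    fix g assume "g \<in> range (\<lambda>f. T f - \<mu> *\<^sub>C f)"
    then obtain f where g: "g = T f - \<mu> *\<^sub>C f" by blast
    have "g = (W f - \<mu> *\<^sub>C f) - cinner f (bwd (Suc 0)) *\<^sub>C e"
      unfolding g T_minus by (simp add: a L2.scale_minus_left)
    then have "Res \<mu> g = f - cinner f (bwd (Suc 0)) *\<^sub>C Res \<mu> e"
      by (simp only: Res_linear(2)[OF mu1, of "W f - \<mu> *\<^sub>C f"] Res_inverse(2)[OF mu1] Res_linear(3)[OF mu1])
    then have "cinner (Res \<mu> g) (bwd (Suc 0)) = 0"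
      by (simp add: cinner_diff_left cinner_scaleC_left \<kappa>)
    then show "g \<in> orth {v}" by (simp add: orth_def v)
  qed
  have "closed (range (\<lambda>f. T f - \<mu> *\<^sub>C f))"
    unfolding range by (rule closed_orth)
  moreover have "{f \<in> UNIV. T f - \<mu> *\<^sub>C f = 0} \<subseteq> L2.span {Res \<mu> e}"
  proof
    fix f assume "f \<in> {f \<in> UNIV. T f - \<mu> *\<^sub>C f = 0}"
    then have "W f - \<mu> *\<^sub>C f = cinner f (bwd (Suc 0)) *\<^sub>C e"
      unfolding T_minus by (simp add: a L2.scale_minus_left)
    then have "Res \<mu> (W f - \<mu> *\<^sub>C f) = cinner f (bwd (Suc 0)) *\<^sub>C Res \<mu> e"
      by (simp only: Res_linear(3)[OF mu1])
    then have "f = cinner f (bwd (Suc 0)) *\<^sub>C Res \<mu> e" by (simp only: Res_inverse(2)[OF mu1])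
    moreover have "cinner f (bwd (Suc 0)) *\<^sub>C Res \<mu> e \<in> L2.span {Res \<mu> e}"
      by (intro L2.span_scale L2.span_base) simp
    ultimately show "f \<in> L2.span {Res \<mu> e}" by argo
  qed
  moreover have "UNIV \<subseteq> L2.span (range (\<lambda>f. T f - \<mu> *\<^sub>C f) \<union> {e})"
  proof
    fix g :: L2_circle
    have "cinner e v = 1" using v[of e] \<kappa> by simp
    then have "g - cinner g v *\<^sub>C e \<in> orth {v}"
      by (simp add: orth_def cinner_diff_left cinner_scaleC_left)
    then have "g - cinner g v *\<^sub>C e \<in> L2.span (orth {v} \<union> {e})"
      by (intro L2.span_base) simp
    moreover have "cinner g v *\<^sub>C e \<in> L2.span (orth {v} \<union> {e})"
      by (intro L2.span_scale L2.span_base) simp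
    ultimately have "(g - cinner g v *\<^sub>C e) + cinner g v *\<^sub>C e \<in> L2.span (orth {v} \<union> {e})"
      by (rule L2.span_add)
    then show "g \<in> L2.span (range (\<lambda>f. T f - \<mu> *\<^sub>C f) \<union> {e})" by (simp add: range)
  qed
  ultimately show "fredholm_on UNIV (\<lambda>f. T f - \<mu> *\<^sub>C f)"
    unfolding fredholm_on_def by (intro conjI exI[of _ "{Res \<mu> e}"] exI[of _ "{e}"]) auto
qed

end

section \<open>Transfer along an isometry\<close>

lemma closed_isometric_image:
  fixes J :: "'a::banach \<Rightarrow> 'b::real_normed_vector"
  assumes J: "\<And>f g. norm (J f - J g) = norm (f - g)" and X: "closed X"
  shows "closed (J ` X)"
  unfolding closed_sequential_limits
proof (intro allI impI, elim conjE)
  fix y l assume y: "\<forall>n::nat. y n \<in> J ` X" and l: "y \<longlonglongrightarrow> l"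
  then have "\<forall>n. \<exists>x. x \<in> X \<and> y n = J x" by blast
  then obtain x where "\<forall>n. x n \<in> X \<and> y n = J (x n)" by (rule choice[THEN exE])
  then have x: "\<And>n. x n \<in> X" "\<And>n. y n = J (x n)" by auto
  have "Cauchy y" using l by (rule LIMSEQ_imp_Cauchy)
  then have "Cauchy x" by (simp add: Cauchy_iff x(2) J)
  then obtain k where k: "x \<longlonglongrightarrow> k" using Cauchy_convergent unfolding convergent_def by blast
  have "k \<in> X" using closed_sequentially[OF X x(1) k] .
  have "norm (y n - J k) = norm (x n - k)" for n
    by (simp only: x(2) J)
  then have "(\<lambda>n. norm (y n - J k)) \<longlonglongrightarrow> 0"
    using tendsto_norm_zero[OF LIM_zero[OF k]] by (simp only:)
  then have "(\<lambda>n. y n - J k) \<longlonglongrightarrow> 0"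
    by (rule tendsto_norm_zero_cancel)
  then have "y \<longlonglongrightarrow> J k" by (rule LIM_zero_cancel)
  then have "l = J k" using l by (rule LIMSEQ_unique[rotated])
  then show "l \<in> J ` X" using \<open>k \<in> X\<close> by blast
qed

lemma invertible_on_imp_fredholm_on:
  assumes "invertible_on M A" "\<And>f. f \<in> M \<Longrightarrow> A f \<in> M" "closed M"
  shows "fredholm_on M A"
proof -
  obtain S where S: "bounded_op_on M S" "\<And>f. f \<in> M \<Longrightarrow> S (A f) = f" "\<And>f. f \<in> M \<Longrightarrow> A (S f) = f"
    using assms(1) unfolding invertible_on_def by blast
  have S_M: "S f \<in> M" if "f \<in> M" for f using S(1) that by (simp add: bounded_op_on_def)
  have im: "A ` M = M"
  proof
    show "M \<subseteq> A ` M"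
    proof
      fix f assume "f \<in> M"
      then show "f \<in> A ` M" using S(3)[of f] S_M by (intro image_eqI[of _ _ "S f"]) simp_all
    qed
  qed (use assms(2) in blast)
  have ker: "f = 0" if f: "f \<in> M" "A f = 0" for f
  proof -
    have "S (0 *\<^sub>C A f) = 0 *\<^sub>C S (A f)"
      using S(1) assms(2)[OF f(1)] unfolding bounded_op_on_def by blast
    then show ?thesis using f S(2)[OF f(1)] by simp
  qed
  show ?thesis
    unfolding fredholm_on_def im
  proof (intro conjI)
    have "{f \<in> M. A f = 0} \<subseteq> L2.span {}" using ker by auto
    then show "\<exists>B. finite B \<and> {f \<in> M. A f = 0} \<subseteq> L2.span B" by blast
    have "M \<subseteq> L2.span (M \<union> {})" by (auto intro: L2.span_base)
    then show "\<exists>B. finite B \<and> M \<subseteq> L2.span (M \<union> B)" by blast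
  qed (rule assms(3))
qed

locale isometric_equivalence =
  fixes J :: "L2_circle \<Rightarrow> L2_circle" and M :: "L2_circle set"
  assumes J_add: "J (f + g) = J f + J g"
    and J_scaleC: "J (c *\<^sub>C f) = c *\<^sub>C J f"
    and J_norm: "norm (J f) = norm f"
    and J_range: "range J = M"
begin

lemma J_diff: "J (f - g) = J f - J g"
  using J_add[of "f - g" g] by simp

lemma J_eq_iff: "J f = J g \<longleftrightarrow> f = g"
  using J_norm[of "f - g"] by (auto simp: J_diff)

lemma J_0: "J 0 = 0"
  using J_diff[of 0 0] by simp

lemma J_closed_image: "closed X \<Longrightarrow> closed (J ` X)"
  by (rule closed_isometric_image) (simp add: J_diff[symmetric] J_norm)

lemma closed_M: "closed M"
  using J_closed_image[of UNIV] J_range by simp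

lemma image_conj:
  assumes "\<And>f. A (J f) = J (B f)" shows "A ` M = J ` range B"
  unfolding J_range[symmetric] image_image assms ..

lemma invertible_transfer:
  assumes AB: "\<And>f. A (J f) = J (B f)" and inv: "invertible_on UNIV B"
  shows "invertible_on M A"
proof -
  obtain S where S: "bounded_op_on UNIV S" and SB: "\<And>f. S (B f) = f" "\<And>f. B (S f) = f"
    using inv unfolding invertible_on_def by blast
  define L where "L = inv J"
  have LJ: "L (J f) = f" for f
    unfolding L_def by (rule inv_f_f) (simp add: inj_def J_eq_iff)
  obtain C where C: "\<And>f. norm (S f) \<le> C * norm f"
    using S unfolding bounded_op_on_def by blast
  have S_lin: "S (f + g) = S f + S g" "S (c *\<^sub>C f) = c *\<^sub>C S f" for f g c
    using S unfolding bounded_op_on_def by blast+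
  have "bounded_op_on M (\<lambda>f. J (S (L f)))"
    unfolding bounded_op_on_def J_range[symmetric]
  proof (intro conjI)
    show "\<exists>C. \<forall>f\<in>range J. norm (J (S (L f))) \<le> C * norm f"
      by (intro exI[of _ C]) (auto simp: LJ J_norm C)
  qed (auto simp: LJ J_add[symmetric] J_scaleC[symmetric] S_lin)
  then show ?thesis
    unfolding invertible_on_def J_range[symmetric]
    by (intro exI[of _ "\<lambda>f. J (S (L f))"]) (auto simp: LJ AB SB)
qed

lemma fredholm_transfer:
  assumes AB: "\<And>f. A (J f) = J (B f)" and fr: "fredholm_on UNIV B"
  shows "fredholm_on M A"
proof -
  interpret J: module_hom scaleC scaleC J
    by unfold_locales (simp_all add: J_add J_scaleC)
  obtain E F where cl: "closed (range B)" and E: "finite E" "{f. B f = 0} \<subseteq> L2.span E"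
    and F: "finite F" "UNIV \<subseteq> L2.span (range B \<union> F)"
    using fr unfolding fredholm_on_def by auto
  show ?thesis
    unfolding fredholm_on_def image_conj[of A B, OF AB]
  proof (intro conjI)
    show "closed (J ` range B)" using cl by (rule J_closed_image)
    have "{f \<in> M. A f = 0} \<subseteq> J ` {f. B f = 0}"
      unfolding J_range[symmetric] using J_eq_iff[of _ 0] by (auto simp: AB J_0)
    also have "\<dots> \<subseteq> L2.span (J ` E)"
      unfolding J.span_image using E(2) by blast
    finally show "\<exists>B. finite B \<and> {f \<in> M. A f = 0} \<subseteq> L2.span B"
      using E(1) by blast
    have "M \<subseteq> J ` L2.span (range B \<union> F)"
      unfolding J_range[symmetric] using F(2) by blast
    also have "\<dots> = L2.span (J ` range B \<union> J ` F)"
      by (simp only: J.span_image[symmetric] image_Un)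
    finally show "\<exists>C. finite C \<and> M \<subseteq> L2.span (J ` range B \<union> C)"
      using F(1) by blast
  qed
qed

lemma closed_transfer:
  assumes AB: "\<And>f. A (J f) = J (B f)" and cl: "closed (A ` M)"
  shows "closed (range B)"
proof -
  have "continuous_on UNIV J"
  proof (rule linear_continuous_on, rule bounded_linear_intro[of _ 1])
    show "J (r *\<^sub>R f) = r *\<^sub>R J f" for r f by (simp add: scaleC_of_real[symmetric] J_scaleC)
  qed (simp_all add: J_add J_norm)
  then have "closed (J -` (A ` M))" by (intro closed_vimage cl)
  also have "J -` (A ` M) = range B"
    unfolding image_conj[of A B, OF AB] by (auto simp: J_eq_iff)
  finally show ?thesis .
qed

end

text \<open>Inside and outside the circle \<open>T - \<mu>\<close> is invertible or, for \<open>a = 0\<close> and \<open>\<bar>\<mu>\<bar> < 1\<close>, Fredholm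
  with a nontrivial kernel; on the circle it is injective without closed range.  An isometry carries all
  this over.\<close>

lemma (in weighted_shift) spectra_of_isometric_copy:
  assumes "isometric_equivalence J M" and D: "\<And>f. D (J f) = J (T f)"
  shows "ess_spectrum_on M D = sphere 0 1"
    and "point_spectrum_on M D = (if a = 0 then ball 0 1 else {})"
    and "spectrum_on M D = sphere 0 1 \<union> (if a = 0 then ball 0 1 else {})"
proof -
  interpret isometric_equivalence J M by fact
  have conj: "D (J f) - \<mu> *\<^sub>C J f = J (T f - \<mu> *\<^sub>C f)" for f \<mu>
    by (simp add: D J_diff J_scaleC)
  have maps: "D f - \<mu> *\<^sub>C f \<in> M" if "f \<in> M" for f \<mu>
    using that unfolding J_range[symmetric] by (auto simp: conj)
  have inv: "invertible_on M (\<lambda>f. D f - \<mu> *\<^sub>C f)" if "cmod \<mu> \<noteq> 1" "a \<noteq> 0 \<or> cmod \<mu> > 1" for \<mu>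
    by (rule invertible_transfer[where B = "\<lambda>f. T f - \<mu> *\<^sub>C f", OF conj invertible_off_circle[OF that]])
  have inv_fr: "fredholm_on M (\<lambda>f. D f - \<mu> *\<^sub>C f)" if "invertible_on M (\<lambda>f. D f - \<mu> *\<^sub>C f)" for \<mu>
    using that maps closed_M by (rule invertible_on_imp_fredholm_on)
  have not_fr: "\<not> fredholm_on M (\<lambda>f. D f - \<mu> *\<^sub>C f)" if "cmod \<mu> = 1" for \<mu>
    using closed_transfer[of "\<lambda>f. D f - \<mu> *\<^sub>C f" "\<lambda>f. T f - \<mu> *\<^sub>C f", OF conj] range_not_closed[OF that]
    unfolding fredholm_on_def by blast
  have fr: "fredholm_on M (\<lambda>f. D f - \<mu> *\<^sub>C f)" if mu: "cmod \<mu> \<noteq> 1" for \<mu>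
  proof (cases "a \<noteq> 0 \<or> cmod \<mu> > 1")
    case True
    then show ?thesis by (intro inv_fr inv mu)
  next
    case False
    then show ?thesis
      using mu by (intro fredholm_transfer[where B = "\<lambda>f. T f - \<mu> *\<^sub>C f"] conj zero_weight_inside(3)) auto
  qed
  show "ess_spectrum_on M D = sphere 0 1"
    unfolding ess_spectrum_on_def using fr not_fr by (auto simp: sphere_def)
  have eigen: "\<mu> \<in> point_spectrum_on M D \<longleftrightarrow> (\<exists>f. f \<noteq> 0 \<and> T f = \<mu> *\<^sub>C f)" for \<mu>
    unfolding point_spectrum_on_def J_range[symmetric]
    using J_eq_iff[of _ 0] by (auto simp: D J_0 J_scaleC[symmetric] J_eq_iff)
  have inv_no_eigen: "\<mu> \<notin> point_spectrum_on M D" if invD: "invertible_on M (\<lambda>f. D f - \<mu> *\<^sub>C f)" for \<mu>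
  proof
    assume "\<mu> \<in> point_spectrum_on M D"
    then obtain f where f: "f \<in> M" "f \<noteq> 0" "D f - \<mu> *\<^sub>C f = 0"
      unfolding point_spectrum_on_def by auto
    obtain S where S: "bounded_op_on M S" "S (D f - \<mu> *\<^sub>C f) = f"
      using invD f(1) unfolding invertible_on_def by blast
    have "S (0 *\<^sub>C f) = 0 *\<^sub>C S f"
      using S(1) f(1) unfolding bounded_op_on_def by blast
    then show False using S(2) f by simp
  qed
  show ps: "point_spectrum_on M D = (if a = 0 then ball 0 1 else {})"
  proof (intro set_eqI)
    fix \<mu> :: complex
    consider "cmod \<mu> = 1" | "cmod \<mu> \<noteq> 1" "a \<noteq> 0 \<or> cmod \<mu> > 1" | "a = 0" "cmod \<mu> < 1" by linarith
    then show "\<mu> \<in> point_spectrum_on M D \<longleftrightarrow> \<mu> \<in> (if a = 0 then ball 0 1 else {})"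
    proof cases
      case 1
      then show ?thesis using no_unimodular_eigenvalue[OF 1] by (auto simp: eigen)
    next
      case 2
      then show ?thesis using inv_no_eigen[OF inv[OF 2]] by auto
    next
      case 3
      then show ?thesis using zero_weight_inside(1,2)[OF 3] by (auto simp: eigen)
    qed
  qed
  show "spectrum_on M D = sphere 0 1 \<union> (if a = 0 then ball 0 1 else {})"
  proof (intro set_eqI)
    fix \<mu> :: complex
    consider "cmod \<mu> = 1" | "cmod \<mu> \<noteq> 1" "a \<noteq> 0 \<or> cmod \<mu> > 1" | "a = 0" "cmod \<mu> < 1" by linarith
    then show "\<mu> \<in> spectrum_on M D \<longleftrightarrow> \<mu> \<in> sphere 0 1 \<union> (if a = 0 then ball 0 1 else {})"
    proof cases
      case 1
      then show ?thesis using not_fr[OF 1] inv_fr[of \<mu>] by (auto simp: spectrum_on_def)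
    next
      case 2
      then show ?thesis using inv[OF 2] by (auto simp: spectrum_on_def)
    next
      case 3
      then show ?thesis using inv_no_eigen[of \<mu>] by (auto simp: spectrum_on_def ps)
    qed
  qed
qed

section \<open>The orthogonal complement of the model space\<close>

lemma cinner_mult_id: "cinner (mult_L2 (\<lambda>z. z) f) g = cinner f (mult_L2 cnj g)"
  using cinner_mult_L2[of "\<lambda>z. z" f g] by simp

lemma cinner_mult_cnj: "cinner (mult_L2 cnj f) g = cinner f (mult_L2 (\<lambda>z. z) g)"
  using cinner_mult_L2[of cnj f g] by simp

lemma mult_cnj_mult_id: "mult_L2 cnj (mult_L2 (\<lambda>z. z) f) = f"
  using mult_L2_unimodular_cancel(1)[of "\<lambda>z. z" f] AE_circle_norm by simp

lemma mult_id_mult_cnj: "mult_L2 (\<lambda>z. z) (mult_L2 cnj f) = f"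
  using mult_L2_unimodular_cancel(2)[of "\<lambda>z. z" f] AE_circle_norm by simp

lemma mult_L2_commute:
  "\<lbrakk>ess_bounded \<phi>; ess_bounded \<psi>\<rbrakk> \<Longrightarrow> mult_L2 \<phi> (mult_L2 \<psi> f) = mult_L2 \<psi> (mult_L2 \<phi> f)"
  by (simp add: mult_L2_mult mult.commute)

lemma analytic_linear:
  "\<lbrakk>f \<in> analytic; g \<in> analytic\<rbrakk> \<Longrightarrow> f + g \<in> analytic"
  "\<lbrakk>f \<in> analytic; g \<in> analytic\<rbrakk> \<Longrightarrow> f - g \<in> analytic"
  "f \<in> analytic \<Longrightarrow> c *\<^sub>C f \<in> analytic"
  unfolding analytic_def by (rule orth_add orth_diff orth_scaleC; assumption)+

lemma coanalytic_linear:
  "\<lbrakk>f \<in> coanalytic; g \<in> coanalytic\<rbrakk> \<Longrightarrow> f + g \<in> coanalytic"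
  "\<lbrakk>f \<in> coanalytic; g \<in> coanalytic\<rbrakk> \<Longrightarrow> f - g \<in> coanalytic"
  "f \<in> coanalytic \<Longrightarrow> c *\<^sub>C f \<in> coanalytic"
  unfolding coanalytic_def by (rule orth_add orth_diff orth_scaleC; assumption)+

lemma one_analytic: "one_L2 \<in> analytic"
  using zmon_analytic[of 0] by (simp add: zmon_0)

lemma coanalytic_cinner_one: "g \<in> coanalytic \<Longrightarrow> cinner g one_L2 = 0"
  unfolding coanalytic_iff zmon_0[symmetric] by simp

lemma cinner_one_zmon: "cinner one_L2 (zmon (Suc n)) = 0"
  using orthonormal_seqD[OF orthonormal_zmon, of 0 "Suc n"] by (simp add: zmon_0)

lemma mult_cnj_coanalytic: "g \<in> coanalytic \<Longrightarrow> mult_L2 cnj g \<in> coanalytic"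
  by (simp add: coanalytic_iff cinner_mult_cnj mult_id_zmon)

lemma mult_cnj_one_coanalytic: "mult_L2 cnj one_L2 \<in> coanalytic"
  by (simp add: coanalytic_iff cinner_mult_cnj mult_id_zmon cinner_one_zmon)

lemma mult_id_analytic: "h \<in> analytic \<Longrightarrow> mult_L2 (\<lambda>z. z) h \<in> analytic"
  by (simp add: analytic_iff cinner_mult_id mult_cnj_coanalytic)

lemma cinner_mult_id_one: "h \<in> analytic \<Longrightarrow> cinner (mult_L2 (\<lambda>z. z) h) one_L2 = 0"
  by (simp add: cinner_mult_id analytic_iff mult_cnj_one_coanalytic)

lemma mult_id_coanalytic:
  assumes "g \<in> coanalytic"
  shows "mult_L2 (\<lambda>z. z) g - cinner (mult_L2 (\<lambda>z. z) g) one_L2 *\<^sub>C one_L2 \<in> coanalytic"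
  unfolding coanalytic_iff
proof
  fix n
  show "cinner (mult_L2 (\<lambda>z. z) g - cinner (mult_L2 (\<lambda>z. z) g) one_L2 *\<^sub>C one_L2) (zmon n) = 0"
  proof (cases n)
    case 0
    then show ?thesis by (simp add: zmon_0 cinner_diff_left cinner_scaleC_left cinner_one_one)
  next
    case (Suc m)
    have "cinner (mult_L2 (\<lambda>z. z) g) (zmon (Suc m)) = cinner g (zmon m)"
      by (simp add: cinner_mult_id mult_id_zmon[symmetric] mult_cnj_mult_id)
    then show ?thesis
      using assms Suc by (simp add: cinner_diff_left cinner_scaleC_left cinner_one_zmon coanalytic_iff)
  qed
qed

text \<open>Multiplication by \<open>z\<close> maps a coanalytic function to a coanalytic one plus a constant, and the
  subtracted mean value makes the constant invisible.\<close>

lemma backward_shift_analytic: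
  assumes "h \<in> analytic"
  shows "mult_L2 cnj (h - cinner h one_L2 *\<^sub>C one_L2) \<in> analytic"
  unfolding analytic_iff
proof
  fix g assume "g \<in> coanalytic"
  let ?h = "h - cinner h one_L2 *\<^sub>C one_L2" and ?g = "mult_L2 (\<lambda>z. z) g"
  have "?h \<in> analytic" using assms one_analytic by (intro analytic_linear)
  then have "cinner ?h (?g - cinner ?g one_L2 *\<^sub>C one_L2) = 0"
    using mult_id_coanalytic[OF \<open>g \<in> coanalytic\<close>] analytic_coanalytic_orth by blast
  moreover have "cinner ?h one_L2 = 0"
    by (simp add: cinner_diff_left cinner_scaleC_left cinner_one_one)
  ultimately have "cinner ?h ?g = 0"
    by (simp add: cinner_diff_right cinner_scaleC_right)
  then show "cinner (mult_L2 cnj ?h) g = 0" by (simp only: cinner_mult_cnj)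
qed

lemma analytic_part_linear:
  "analytic_part (f + g) = analytic_part f + analytic_part g"
  "analytic_part (c *\<^sub>C f) = c *\<^sub>C analytic_part f"
proof -
  have "f + g - (analytic_part f + analytic_part g) = (f - analytic_part f) + (g - analytic_part g)" by simp
  then show "analytic_part (f + g) = analytic_part f + analytic_part g"
    by (intro analytic_part_eqI analytic_linear analytic_part_in)
       (simp only: coanalytic_linear coanalytic_part_in)
  have "c *\<^sub>C f - c *\<^sub>C analytic_part f = c *\<^sub>C (f - analytic_part f)" by (simp add: scaleC_diff_right)
  then show "analytic_part (c *\<^sub>C f) = c *\<^sub>C analytic_part f"
    by (intro analytic_part_eqI analytic_linear analytic_part_in)
       (simp only: coanalytic_linear coanalytic_part_in)
qed

lemma norm_analytic_part: "(norm f)\<^sup>2 = (norm (f - analytic_part f))\<^sup>2 + (norm (analytic_part f))\<^sup>2"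
  using norm_add_orthogonal[of "f - analytic_part f" "analytic_part f"]
    analytic_coanalytic_orth[OF analytic_part_in[of f] coanalytic_part_in[of f]] by simp

locale inner_fun =
  fixes \<theta> :: "complex \<Rightarrow> complex"
  assumes inner: "inner_function \<theta>"
begin

definition M\<theta> :: "L2_circle \<Rightarrow> L2_circle" where "M\<theta> = mult_L2 (radial_limit \<theta>)"
definition M\<theta>' :: "L2_circle \<Rightarrow> L2_circle" where "M\<theta>' = mult_L2 (\<lambda>z. cnj (radial_limit \<theta> z))"

lemmas bounded = inner_boundary(1)[OF inner]
lemmas unimodular = inner_boundary(2)[OF inner]

lemma M\<theta>_linear: "M\<theta> (f + g) = M\<theta> f + M\<theta> g" "M\<theta> (f - g) = M\<theta> f - M\<theta> g" "M\<theta> (c *\<^sub>C f) = c *\<^sub>C M\<theta> f"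
  by (simp_all add: M\<theta>_def bounded mult_L2_add mult_L2_diff mult_L2_scaleC)

lemma M\<theta>_cancel: "M\<theta>' (M\<theta> f) = f" "M\<theta> (M\<theta>' f) = f"
  unfolding M\<theta>_def M\<theta>'_def by (rule mult_L2_unimodular_cancel[OF bounded unimodular])+

lemma cinner_M\<theta>: "cinner (M\<theta> f) g = cinner f (M\<theta>' g)"
  by (simp add: M\<theta>_def M\<theta>'_def cinner_mult_L2 bounded)

lemma cinner_M\<theta>': "cinner (M\<theta>' f) g = cinner f (M\<theta> g)"
  by (simp add: M\<theta>_def M\<theta>'_def cinner_mult_L2 bounded ess_bounded_cnj)

lemma cinner_M\<theta>_M\<theta>: "cinner (M\<theta> f) (M\<theta> g) = cinner f g"
  by (simp add: cinner_M\<theta> M\<theta>_cancel)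

lemma norm_M\<theta>: "norm (M\<theta> f) = norm f"
  by (simp add: norm_L2_circle_def inner_L2_circle_def cinner_M\<theta>_M\<theta>)

lemma M\<theta>_id: "M\<theta> (mult_L2 (\<lambda>z. z) f) = mult_L2 (\<lambda>z. z) (M\<theta> f)"
  and M\<theta>_cnj: "M\<theta> (mult_L2 cnj f) = mult_L2 cnj (M\<theta> f)"
  by (simp_all add: M\<theta>_def mult_L2_commute bounded)

lemma M\<theta>_one: "M\<theta> one_L2 \<in> analytic" "cinner (M\<theta> one_L2) one_L2 = \<theta> 0"
  using inner_analytic[OF inner] by (simp_all add: M\<theta>_def mult_L2_one bounded)

lemma M\<theta>_zmon: "M\<theta> (zmon n) \<in> analytic"
  by (induction n) (simp_all add: zmon_0 M\<theta>_one mult_id_zmon[symmetric] M\<theta>_id mult_id_analytic)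

lemma M\<theta>'_coanalytic: "g \<in> coanalytic \<Longrightarrow> M\<theta>' g \<in> coanalytic"
  using analytic_coanalytic_orth[OF M\<theta>_zmon] by (simp add: coanalytic_iff[of "M\<theta>' g"] cinner_M\<theta>')

lemma M\<theta>_analytic: "h \<in> analytic \<Longrightarrow> M\<theta> h \<in> analytic"
  by (simp add: analytic_iff cinner_M\<theta> M\<theta>'_coanalytic)

text \<open>Taking the mean value is multiplicative on analytic functions.  Here it follows since
  the conjugate of \<open>\<theta>\<close> minus its mean value is coanalytic.\<close>

lemma cinner_M\<theta>_one:
  assumes "h \<in> analytic" shows "cinner (M\<theta> h) one_L2 = \<theta> 0 * cinner h one_L2"
proof -
  have "M\<theta>' one_L2 - cnj (\<theta> 0) *\<^sub>C one_L2 \<in> coanalytic"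
    unfolding coanalytic_iff
  proof
    fix n
    show "cinner (M\<theta>' one_L2 - cnj (\<theta> 0) *\<^sub>C one_L2) (zmon n) = 0"
    proof (cases n)
      case 0
      have "cinner one_L2 (M\<theta> one_L2) = cnj (\<theta> 0)"
        by (subst cinner_commute) (simp add: M\<theta>_one)
      then show ?thesis
        using 0 by (simp add: zmon_0 cinner_diff_left cinner_scaleC_left cinner_M\<theta>' cinner_one_one)
    next
      case (Suc m)
      have "cinner (M\<theta> (zmon (Suc m))) one_L2 = 0"
        unfolding mult_id_zmon[symmetric] M\<theta>_id by (rule cinner_mult_id_one[OF M\<theta>_zmon])
      then have "cinner one_L2 (M\<theta> (zmon (Suc m))) = 0"
        by (simp only: cinner_eq_0_commute)
      then show ?thesis
        using Suc by (simp add: cinner_diff_left cinner_scaleC_left cinner_M\<theta>' cinner_one_zmon)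
    qed
  qed
  then have "cinner h (M\<theta>' one_L2 - cnj (\<theta> 0) *\<^sub>C one_L2) = 0"
    using assms analytic_coanalytic_orth by blast
  then show ?thesis by (simp add: cinner_M\<theta> cinner_diff_right cinner_scaleC_right)
qed

lemma model_space_iff: "f \<in> model_space \<theta> \<longleftrightarrow> f \<in> analytic \<and> (\<forall>h\<in>analytic. cinner f (M\<theta> h) = 0)"
  by (auto simp: model_space_def orth_def M\<theta>_def H2_eq_analytic)

text \<open>Both summands lie in the complement of the model space, the first because the model space is
  analytic, the second because it is a multiple of \<open>\<theta>\<close>.\<close>

definition J :: "L2_circle \<Rightarrow> L2_circle" where
  "J f = (f - analytic_part f) + M\<theta> (analytic_part f)"

lemma coanalytic_perp: "g \<in> coanalytic \<Longrightarrow> g \<in> model_space_perp \<theta>"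
  using analytic_coanalytic_orth by (auto simp: model_space_perp_def orth_def model_space_iff)

lemma M\<theta>_perp: "h \<in> analytic \<Longrightarrow> M\<theta> h \<in> model_space_perp \<theta>"
  by (auto simp: model_space_perp_def orth_def model_space_iff cinner_eq_0_commute[of "M\<theta> h"])

lemma J_in_perp: "J f \<in> model_space_perp \<theta>"
  unfolding J_def using coanalytic_perp[OF coanalytic_part_in] M\<theta>_perp[OF analytic_part_in]
  by (simp add: model_space_perp_def orth_add)

text \<open>For \<open>f\<close> orthogonal to the model space and \<open>p\<close> its analytic part, project \<open>cnj \<theta> p\<close> to the analytic
  function \<open>k\<close>.  The difference \<open>p - \<theta> k\<close> is analytic and orthogonal to all multiples of \<open>\<theta>\<close>, so
  it is in the model space, but it is also orthogonal to it; hence \<open>p = \<theta> k\<close>.\<close>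

lemma J_surj:
  assumes f: "f \<in> model_space_perp \<theta>" shows "f \<in> range J"
proof -
  let ?p = "analytic_part f"
  define k where "k = analytic_part (M\<theta>' ?p)"
  define x where "x = ?p - M\<theta> k"
  have k: "k \<in> analytic" by (simp add: k_def analytic_part_in)
  have "cinner x (M\<theta> h) = 0" if "h \<in> analytic" for h
  proof -
    have "cinner x (M\<theta> h) = cinner (M\<theta>' ?p - k) h"
      by (simp add: x_def cinner_diff_left cinner_M\<theta>' cinner_M\<theta>_M\<theta>)
    then show ?thesis
      using analytic_coanalytic_orth[OF that coanalytic_part_in[of "M\<theta>' ?p"]] by (simp add: k_def)
  qed
  then have "x \<in> model_space \<theta>"
    by (simp add: model_space_iff x_def analytic_linear analytic_part_in M\<theta>_analytic k)
  moreover have "x \<in> model_space_perp \<theta>"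
  proof -
    have "x = f - (f - ?p) - M\<theta> k" by (simp add: x_def)
    then show ?thesis
      using f coanalytic_perp[OF coanalytic_part_in[of f]] M\<theta>_perp[OF k]
      unfolding model_space_perp_def by (simp only: orth_diff)
  qed
  ultimately have "cinner x x = 0"
    unfolding model_space_perp_def orth_def by blast
  then have x0: "M\<theta> k = ?p" by (simp add: cinner_self x_def)
  have "analytic_part (f - ?p + k) = k"
    by (rule analytic_part_eqI[OF k]) (simp add: coanalytic_part_in)
  then have "J (f - ?p + k) = f" by (simp add: J_def x0)
  then show ?thesis by (metis rangeI)
qed

lemma isometric_equivalence_J: "isometric_equivalence J (model_space_perp \<theta>)"
proof
  fix f g c
  show "J (f + g) = J f + J g" by (simp add: J_def analytic_part_linear M\<theta>_linear)
  show "J (c *\<^sub>C f) = c *\<^sub>C J f"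
    by (simp add: J_def analytic_part_linear M\<theta>_linear scaleC_diff_right scaleC_algebra(1))
  have "cinner (f - analytic_part f) (M\<theta> (analytic_part f)) = 0"
    using analytic_coanalytic_orth[OF M\<theta>_analytic[OF analytic_part_in] coanalytic_part_in] by blast
  then have "(norm (J f))\<^sup>2 = (norm f)\<^sup>2"
    by (simp add: J_def norm_add_orthogonal norm_M\<theta> norm_analytic_part[of f])
  then show "norm (J f) = norm f" by (rule power2_eq_imp_eq) auto
  show "range J = model_space_perp \<theta>" using J_in_perp J_surj by blast
qed

lemma dual_TTO_eqI:
  assumes "g \<in> model_space_perp \<theta>" "mult_L2 \<phi> f - g \<in> model_space \<theta>"
  shows "dual_TTO \<theta> \<phi> f = g"
  unfolding dual_TTO_def model_space_perp_def
proof (rule proj_orth_eqI)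
  show "g \<in> orth (model_space \<theta>)" using assms(1) by (simp add: model_space_perp_def)
  show "mult_L2 \<phi> f - g \<in> orth (orth (model_space \<theta>))"
    using assms(2) cinner_eq_0_commute by (auto simp: orth_def)
qed

lemma model_space_scaleC: "f \<in> model_space \<theta> \<Longrightarrow> c *\<^sub>C f \<in> model_space \<theta>"
  by (simp add: model_space_iff analytic_linear cinner_scaleC_left)

text \<open>This is the reproducing kernel of the model space at the origin.\<close>

lemma kernel_at_0_model_space: "one_L2 - cnj (\<theta> 0) *\<^sub>C M\<theta> one_L2 \<in> model_space \<theta>"
  unfolding model_space_iff
proof
  show "one_L2 - cnj (\<theta> 0) *\<^sub>C M\<theta> one_L2 \<in> analytic"
    by (intro analytic_linear one_analytic M\<theta>_one)
  show "\<forall>h\<in>analytic. cinner (one_L2 - cnj (\<theta> 0) *\<^sub>C M\<theta> one_L2) (M\<theta> h) = 0"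
  proof
    fix h assume h: "h \<in> analytic"
    have "cinner one_L2 (M\<theta> h) = cnj (\<theta> 0 * cinner h one_L2)"
      by (subst cinner_commute) (simp only: cinner_M\<theta>_one[OF h])
    also have "\<dots> = cnj (\<theta> 0) * cinner one_L2 h"
      by (subst cinner_commute[of one_L2 h]) simp
    finally show "cinner (one_L2 - cnj (\<theta> 0) *\<^sub>C M\<theta> one_L2) (M\<theta> h) = 0"
      by (simp add: cinner_diff_left cinner_scaleC_left cinner_M\<theta>_M\<theta>)
  qed
qed

text \<open>The difference quotient \<open>(\<theta> z - \<theta> 0) / z\<close>, the conjugate of the reproducing kernel at the
  origin.\<close>

lemma conjugate_kernel_at_0_model_space: "mult_L2 cnj (M\<theta> one_L2 - \<theta> 0 *\<^sub>C one_L2) \<in> model_space \<theta>"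
  unfolding model_space_iff
proof
  show "mult_L2 cnj (M\<theta> one_L2 - \<theta> 0 *\<^sub>C one_L2) \<in> analytic"
    using backward_shift_analytic[OF M\<theta>_one(1)] by (simp only: M\<theta>_one(2))
  show "\<forall>h\<in>analytic. cinner (mult_L2 cnj (M\<theta> one_L2 - \<theta> 0 *\<^sub>C one_L2)) (M\<theta> h) = 0"
  proof
    fix h assume h: "h \<in> analytic"
    let ?zh = "mult_L2 (\<lambda>z. z) h"
    have "cinner one_L2 ?zh = 0"
      using cinner_mult_id_one[OF h] by (simp only: cinner_eq_0_commute)
    moreover have "cinner one_L2 (mult_L2 (\<lambda>z. z) (M\<theta> h)) = 0"
      using cinner_mult_id_one[OF M\<theta>_analytic[OF h]] by (simp only: cinner_eq_0_commute)
    ultimately show "cinner (mult_L2 cnj (M\<theta> one_L2 - \<theta> 0 *\<^sub>C one_L2)) (M\<theta> h) = 0"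
      by (simp add: cinner_mult_cnj cinner_diff_left cinner_scaleC_left M\<theta>_id[symmetric] cinner_M\<theta>_M\<theta>)
  qed
qed

lemma weighted_shift_id: "weighted_shift (\<lambda>z. z) one_L2"
  by unfold_locales (simp_all add: AE_circle_norm AE_circle_neq cinner_one_one cinner_power_one)

lemma weighted_shift_cnj: "weighted_shift cnj (mult_L2 cnj one_L2)"
proof
  show "AE z in circle_measure. cmod (cnj z) = 1" using AE_circle_norm by simp
  show "AE z in circle_measure. cnj z \<noteq> w" for w
    using AE_circle_neq[of "cnj w"] by eventually_elim auto
  show "cinner (mult_L2 cnj one_L2) (mult_L2 cnj one_L2) = 1"
    by (simp add: cinner_mult_cnj mult_id_mult_cnj cinner_one_one)
  fix n :: nat assume "n > 0"
  have p: "ess_bounded (\<lambda>z. cnj z ^ n)"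
    using ess_bounded_cnj[OF ess_bounded_power[of n]] by simp
  have "cinner (mult_L2 (\<lambda>z. cnj z ^ n) (mult_L2 cnj one_L2)) (mult_L2 cnj one_L2)
     = cinner (mult_L2 (\<lambda>z. cnj z ^ n) one_L2) one_L2"
    by (simp add: mult_L2_commute[OF p ess_bounded_cnj_id] cinner_mult_cnj[of _ "mult_L2 cnj one_L2"] mult_id_mult_cnj)
  also have "\<dots> = cinner one_L2 (mult_L2 (\<lambda>z. z ^ n) one_L2)"
    by (simp add: cinner_mult_L2 p)
  also have "\<dots> = 0"
    using cinner_power_one[OF \<open>n > 0\<close>] by (simp only: cinner_eq_0_commute)
  finally show "cinner (mult_L2 (\<lambda>z. cnj z ^ n) (mult_L2 cnj one_L2)) (mult_L2 cnj one_L2) = 0" .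
qed simp

text \<open>Write \<open>f = q + p\<close> with \<open>q\<close> coanalytic and \<open>p\<close> analytic.  Multiplying \<open>J f = q + \<theta> p\<close> by \<open>z\<close> spills the
  constant \<open>c\<close> out of the coanalytic part, and \<open>c\<close> equals \<open>c cnj (\<theta> 0) \<theta>\<close> up to a multiple of the
  kernel at the origin, which the projection removes.\<close>

lemma dual_TTO_id_J:
  "dual_TTO \<theta> (\<lambda>z. z) (J f) = J (weighted_shift.T (\<lambda>z. z) one_L2 (cnj (\<theta> 0)) f)"
proof (rule dual_TTO_eqI[OF J_in_perp])
  interpret weighted_shift "\<lambda>z. z" one_L2 "cnj (\<theta> 0)" by (rule weighted_shift_id)
  define Z where "Z = mult_L2 (\<lambda>z. z)"
  define p where "p = analytic_part f"
  define q where "q = f - p"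
  define c where "c = cinner (Z f) one_L2"
  have Z: "Z (f + g) = Z f + Z g" "Z (f - g) = Z f - Z g" for f g
    by (simp_all add: Z_def mult_L2_add mult_L2_diff)
  have p: "p \<in> analytic" and q: "q \<in> coanalytic" and f: "f = q + p"
    by (simp_all add: p_def q_def analytic_part_in coanalytic_part_in)
  have c: "c = cinner (Z q) one_L2"
    unfolding c_def f Z cinner_add_left using cinner_mult_id_one[OF p] by (simp add: Z_def)
  have q': "Z q - c *\<^sub>C one_L2 \<in> coanalytic"
    unfolding c Z_def by (rule mult_id_coanalytic[OF q])
  have T: "T f = Z f + ((cnj (\<theta> 0) - 1) * c) *\<^sub>C one_L2"
    by (simp add: T_def W_def Z_def c_def)
  have T_split: "T f = (Z q - c *\<^sub>C one_L2) + (Z p + (cnj (\<theta> 0) * c) *\<^sub>C one_L2)"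
    unfolding T by (subst f) (simp add: Z left_diff_distrib L2.scale_left_diff_distrib)
  have "analytic_part (T f) = Z p + (cnj (\<theta> 0) * c) *\<^sub>C one_L2"
  proof (rule analytic_part_eqI)
    show "Z p + (cnj (\<theta> 0) * c) *\<^sub>C one_L2 \<in> analytic"
      unfolding Z_def by (intro analytic_linear mult_id_analytic p one_analytic)
  qed (simp add: T_split q')
  then have "J (T f) = (Z q - c *\<^sub>C one_L2) + M\<theta> (Z p + (cnj (\<theta> 0) * c) *\<^sub>C one_L2)"
    unfolding J_def by (simp add: T_split)
  moreover have "J f = q + M\<theta> p" by (simp add: J_def p_def q_def)
  ultimately have "Z (J f) - J (T f) = c *\<^sub>C (one_L2 - cnj (\<theta> 0) *\<^sub>C M\<theta> one_L2)"
    by (simp add: Z M\<theta>_linear M\<theta>_id[folded Z_def] scaleC_diff_right scaleC_algebra(3) mult.commute)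
  then show "mult_L2 (\<lambda>z. z) (J f) - J (T f) \<in> model_space \<theta>"
    using model_space_scaleC[OF kernel_at_0_model_space] by (simp add: Z_def)
qed

text \<open>Now the mean value \<open>c\<close> of \<open>p\<close> is pushed out of the analytic part: \<open>c \<theta> cnj z\<close> equals
  \<open>c \<theta> 0 cnj z\<close> up to a multiple of the conjugate kernel.\<close>

lemma dual_TTO_cnj_J:
  "dual_TTO \<theta> cnj (J f) = J (weighted_shift.T cnj (mult_L2 cnj one_L2) (\<theta> 0) f)"
proof (rule dual_TTO_eqI[OF J_in_perp])
  interpret weighted_shift cnj "mult_L2 cnj one_L2" "\<theta> 0" by (rule weighted_shift_cnj)
  define Z where "Z = mult_L2 cnj"
  define p where "p = analytic_part f"
  define q where "q = f - p"
  define c where "c = cinner p one_L2"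
  have Z: "Z (f + g) = Z f + Z g" "Z (f - g) = Z f - Z g" "Z (k *\<^sub>C f) = k *\<^sub>C Z f" for f g k
    by (simp_all add: Z_def mult_L2_add mult_L2_diff mult_L2_scaleC)
  have p: "p \<in> analytic" and q: "q \<in> coanalytic" and f: "f = q + p"
    by (simp_all add: p_def q_def analytic_part_in coanalytic_part_in)
  have c: "cinner (Z f) (mult_L2 cnj one_L2) = c"
  proof -
    have "cinner (Z f) (mult_L2 cnj one_L2) = cinner f one_L2"
      by (simp add: Z_def cinner_mult_cnj mult_id_mult_cnj)
    then show ?thesis using coanalytic_cinner_one[OF q] by (simp add: f cinner_add_left c_def)
  qed
  have T: "T f = Z f + ((\<theta> 0 - 1) * c) *\<^sub>C Z one_L2"
    using c by (simp add: T_def W_def Z_def)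
  have T_split: "T f = (Z q + (\<theta> 0 * c) *\<^sub>C Z one_L2) + Z (p - c *\<^sub>C one_L2)"
    unfolding T by (subst f) (simp add: Z left_diff_distrib L2.scale_left_diff_distrib)
  have "analytic_part (T f) = Z (p - c *\<^sub>C one_L2)"
  proof (rule analytic_part_eqI)
    show "Z (p - c *\<^sub>C one_L2) \<in> analytic"
      unfolding Z_def c_def by (rule backward_shift_analytic[OF p])
    have "Z q + (\<theta> 0 * c) *\<^sub>C Z one_L2 \<in> coanalytic"
      unfolding Z_def by (intro coanalytic_linear mult_cnj_coanalytic q mult_cnj_one_coanalytic)
    then show "T f - Z (p - c *\<^sub>C one_L2) \<in> coanalytic" by (simp add: T_split)
  qed
  then have "J (T f) = (Z q + (\<theta> 0 * c) *\<^sub>C Z one_L2) + M\<theta> (Z (p - c *\<^sub>C one_L2))"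
    unfolding J_def by (simp add: T_split)
  moreover have "J f = q + M\<theta> p" by (simp add: J_def p_def q_def)
  ultimately have "Z (J f) - J (T f) = c *\<^sub>C Z (M\<theta> one_L2 - \<theta> 0 *\<^sub>C one_L2)"
    by (simp add: Z M\<theta>_linear M\<theta>_cnj[folded Z_def] scaleC_diff_right scaleC_algebra(3) mult.commute)
  then show "mult_L2 cnj (J f) - J (T f) \<in> model_space \<theta>"
    using model_space_scaleC[OF conjugate_kernel_at_0_model_space] by (simp add: Z_def)
qed

end

theorem corollary8p13:
  fixes \<theta> :: "complex \<Rightarrow> complex"
  assumes "inner_function \<theta>"
  shows "ess_spectrum_on (model_space_perp \<theta>) (dual_TTO \<theta> (\<lambda>z. z)) = sphere 0 1 \<and>
    ess_spectrum_on (model_space_perp \<theta>) (dual_TTO \<theta> cnj) = sphere 0 1 \<and>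
    point_spectrum_on (model_space_perp \<theta>) (dual_TTO \<theta> (\<lambda>z. z)) = point_spectrum_on (model_space_perp \<theta>) (dual_TTO \<theta> cnj) \<and>
    sphere 0 1 \<inter> point_spectrum_on (model_space_perp \<theta>) (dual_TTO \<theta> (\<lambda>z. z)) = {} \<and>
    spectrum_on (model_space_perp \<theta>) (dual_TTO \<theta> (\<lambda>z. z)) = sphere 0 1 \<union> point_spectrum_on (model_space_perp \<theta>) (dual_TTO \<theta> (\<lambda>z. z)) \<and>
    spectrum_on (model_space_perp \<theta>) (dual_TTO \<theta> cnj) = sphere 0 1 \<union> point_spectrum_on (model_space_perp \<theta>) (dual_TTO \<theta> (\<lambda>z. z)) \<and>
    (\<theta> 0 \<noteq> 0 \<longrightarrow> point_spectrum_on (model_space_perp \<theta>) (dual_TTO \<theta> (\<lambda>z. z)) = {}) \<and>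
    (\<theta> 0 = 0 \<longrightarrow> point_spectrum_on (model_space_perp \<theta>) (dual_TTO \<theta> (\<lambda>z. z)) = ball 0 1)"
proof -
  interpret inner_fun \<theta> using assms by unfold_locales
  note spectra_z = weighted_shift.spectra_of_isometric_copy
    [OF weighted_shift_id isometric_equivalence_J, OF dual_TTO_id_J]
  note spectra_cnj = weighted_shift.spectra_of_isometric_copy
    [OF weighted_shift_cnj isometric_equivalence_J, OF dual_TTO_cnj_J]
  show ?thesis
    unfolding spectra_z spectra_cnj by auto
qed

end
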